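(* Let $A\in\mathbb{R}^{m\times n}$ with $m<n$ have full row rank, let $b\in\mathbb{R}^m$ and $\epsilon\ge 0$ with $\|b\|_2>\epsilon$, and let $$G(x)=\frac{\|x\|_1^2}{\|x\|_2^2}+\iota_{\mathcal{B}_\epsilon(0)}(Ax-b),\qquad \mathrm{dom}\,G=\{x\in\mathbb{R}^n:\|Ax-b\|_2\le\epsilon\}.$$ Let $\{(x^{(k)},\alpha^{(k)})\}_{k\ge 0}$ be a sequence generated by the following scheme: $x^{(0)}\in\mathbb{R}^n$ satisfies $Ax^{(0)}=b$, $\alpha^{(0)}=\|x^{(0)}\|_1^2/\|x^{(0)}\|_2^2$, and for $k=0,1,2,\dots$ $$x^{(k+1)}\in\arg\min\{\|x\|_1^2-2\alpha^{(k)}\langle x^{(k)},x\rangle:\ \|Ax-b\|_2\le\epsilon\},\qquad \alpha^{(k+1)}=\frac{\|x^{(k+1)}\|_1^2}{\|x^{(k+1)}\|_2^2}.$$ If $\{x^{(k)}\}$ is bounded, then $\{x^{(k)}\}$ converges to a stationary point of $G$.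
   Context: $\mathcal{B}_\epsilon(z)$ is the closed Euclidean ball centered at $z$ with radius $\epsilon$ (so $\mathcal{B}_0(0)=\{0\}$). For a nonempty closed set $C$, the indicator function $\iota_C(x)$ is $0$ if $x\in C$ and $+\infty$ otherwise. For a proper closed (lower semicontinuous) function $f:\mathbb{R}^n\to(-\infty,\infty]$ and $\bar{x}\in\mathrm{dom} f=\{x:f(x)<\infty\}$, the regular subdifferential is $$\hat{\partial}f(\bar{x})=\left\{v:\ \liminf_{x\to\bar{x},\,x\ne\bar{x}}\frac{f(x)-f(\bar{x})-\langle v,x-\bar{x}\rangle}{\|x-\bar{x}\|_2}\ge 0\right\},$$ and the limiting subdifferential is $$\partial f(\bar{x})=\left\{v:\ \exists\, x^{(t)}\to\bar{x}\text{ with } f(x^{(t)})\to f(\bar{x}),\ \exists\, v^{(t)}\in\hat{\partial}f(x^{(t)})\text{ with } v^{(t)}\to v\right\}.$$ A point $\bar{x}$ is a stationary point of $f$ if $0\in\partial f(\bar{x})$. Since $\|b\|_2>\epsilon$, the point $0$ is infeasible, so the quotient in $G$ is well defined on the feasible set; $G=+\infty$ off the feasible set (including at $0$). *)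

theory Defs
  imports "HOL-Analysis.Analysis"
begin

definition l1_norm :: "real ^ 'n \<Rightarrow> real" where
  "l1_norm x = (\<Sum>i\<in>UNIV. \<bar>x $ i\<bar>)"

definition indicator_fun :: "'a set \<Rightarrow> 'a \<Rightarrow> ereal" where
  "indicator_fun C x = (if x \<in> C then 0 else \<infinity>)"

definition effective_domain :: "('a \<Rightarrow> ereal) \<Rightarrow> 'a set" where
  "effective_domain f = {x. f x < \<infinity>}"

(* Intended for functions that never take the value -\<infinity>, so that
   f xbar is finite below. Both subdifferentials are empty outside the effective domain. *)
definition regular_subdifferential :: "('a::real_inner \<Rightarrow> ereal) \<Rightarrow> 'a \<Rightarrow> 'a set" where
  "regular_subdifferential f xbar =
     {v. xbar \<in> effective_domain f \<and>
         Liminf (at xbar)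
           (\<lambda>x. (f x - f xbar - ereal (v \<bullet> (x - xbar))) / ereal (norm (x - xbar))) \<ge> 0}"

definition limiting_subdifferential :: "('a::real_inner \<Rightarrow> ereal) \<Rightarrow> 'a \<Rightarrow> 'a set" where
  "limiting_subdifferential f xbar =
     {v. xbar \<in> effective_domain f \<and>
         (\<exists>xs vs. xs \<longlonglongrightarrow> xbar \<and> (\<lambda>t. f (xs t)) \<longlonglongrightarrow> f xbar \<and>
            (\<forall>t. vs t \<in> regular_subdifferential f (xs t)) \<and> vs \<longlonglongrightarrow> v)}"

definition stationary_point :: "('a::real_inner \<Rightarrow> ereal) \<Rightarrow> 'a \<Rightarrow> bool" where
  "stationary_point f xbar \<longleftrightarrow> 0 \<in> limiting_subdifferential f xbar"

(* If eps < norm b then 0 is infeasible and the value there is \<infinity>;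
   the convention 0 / 0 = 0 in the real quotient plays no role. *)
definition G :: "real ^ 'n ^ 'm \<Rightarrow> real ^ 'm \<Rightarrow> real \<Rightarrow> real ^ 'n \<Rightarrow> ereal" where
  "G A b eps x =
     ereal ((l1_norm x)\<^sup>2 / (norm x)\<^sup>2) + indicator_fun (cball 0 eps) (A *v x - b)"

lemma effective_domain_G: "effective_domain (G A b eps) = {x. norm (A *v x - b) \<le> eps}"
  by (auto simp: effective_domain_def G_def indicator_fun_def)

end

theory Submission
  imports Defs
begin

text \<open>
  Comparing the minimiser x_(k+1) of the k-th subproblem with the competitor x_k gives the
  decrease \<alpha>_k - \<alpha>_(k+1) \<ge> \<alpha>_k |x_(k+1)-x_k|^2 / |x_(k+1)|^2
  (\<open>sufficient_decrease\<close>). So \<alpha>_k decreases to some \<alpha>_* and the steps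
  tend to zero. This alone does not make the whole sequence converge; what is missing is an
  inequality of Lojasiewicz type near a cluster point x_*, bounding the excess v_k = \<alpha>_k -
  \<alpha>_* by a power greater than one of the step length.

  That inequality is proved by hand, because everything is quadratic. Fix the sign pattern
  \<sigma> of an iterate y. On the coordinate subspace V spanned by the face of \<sigma> the l_1
  norm is the linear form \<sigma> \<bullet> y, so f(y) = |y|_1^2 - \<alpha>_* |y|^2 = (\<sigma>
  \<bullet> y)^2 - \<alpha>_*|y|^2 is a quadratic form, and optimality of y says that \<nabla>f(y)
  is, up to an error R comparable with |\<alpha>_k x_k - \<alpha>_* y|, normal to the feasible set
  inside V. Three situations occur. If the ball constraint is inactive at y, there is no
  constraint within V. If it is active and its gradient does not vanish on V, then y lies on the
  quadric |Ay-b| = \<epsilon> and there is a Lagrange multiplier. If the gradient vanishes on V,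
  then \<epsilon> is the distance from b to AV, and the feasible points of V form an affine
  subspace; this is always the case when \<epsilon> = 0. In each case |f(y) - f(x_*)|^3 \<le> C
  R^4 near x_* (\<open>Lojasiewicz_quadratic_on_affine\<close>,
  \<open>Lojasiewicz_quadric_in_subspace\<close>). There are finitely many sign patterns, so one
  constant serves all of them (\<open>Lojasiewicz_at_minimisers\<close>).

  The hard case is the quadric. After subtracting the multiplier of x_* one studies Hw = \<mu>(B^T
  u + B^T B w) + \<rho> with |Bw|^2 + 2u \<bullet> Bw = 0 and small w, \<mu>, \<rho>. Splitting w
  along the kernel of H leaves a few scalar relations between |\<mu>|, |Bw| and R = |\<rho>|
  (\<open>quadric_critical_reduction\<close>), which bound |w \<bullet> Hw| by a constant times
  R^(4/3) (\<open>scalar_balance\<close>). If B^T u has a component in the kernel of H, the bound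
  is even of order R^2; the exponent 4/3 comes from the opposite case.

  From v_(k+1)^3 \<le> C |x_(k+1)-x_k|^4, valid near x_* for large k, and the decrease condition,
  a suitable multiple of v_(k+1)^(1/4), added to |x_(k+1)-x_k| and to |x_(k+1)-x_*|, is a
  nonincreasing potential near x_*; it is small at some index, hence ever after
  (\<open>convergence_by_Lojasiewicz\<close>). Finally the limit solves the subproblem that it
  generates itself, and completing the square there shows that near x_* the function G is bounded
  below by its value at x_* minus a constant times |y-x_*|^2, so that 0 is even a regular
  subgradient (\<open>stationary_point_of_minimiser\<close>).
\<close>


section \<open>Kernels and ranges of self-adjoint maps\<close>

text \<open>On the orthogonal complement of the kernel within V the map f is injective, hence bounded below;
  the component of w in the kernel is the required n.\<close>

lemma kernel_error_bound:
  fixes f :: "'a::euclidean_space \<Rightarrow> 'b::euclidean_space"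
  assumes "linear f" and "subspace V"
  shows "\<exists>C>0. \<forall>w\<in>V. \<exists>n\<in>V. f n = 0 \<and> norm (w - n) \<le> C * norm (f w)"
proof -
  define N where "N = {n\<in>V. f n = 0}"
  define U where "U = {v\<in>V. \<forall>n\<in>N. n \<bullet> v = 0}"
  have subN: "subspace N"
    using assms unfolding N_def subspace_def by (auto simp: linear_add linear_scale linear_0)
  have subU: "subspace U"
    using assms unfolding U_def subspace_def by (auto simp: inner_add_right)
  have inj: "\<forall>v\<in>U. f v = 0 \<longrightarrow> v = 0"
    unfolding U_def N_def using inner_eq_zero_iff by blast
  obtain e where e: "e > 0" "\<forall>v\<in>U. e * norm v \<le> norm (f v)"
    using injective_imp_isometric[OF closed_subspace[OF subU] subU _ inj] assms(1)
    by (auto simp: linear_conv_bounded_linear mult.commute)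
  have "\<exists>n\<in>V. f n = 0 \<and> norm (w - n) \<le> (1/e) * norm (f w)" if "w \<in> V" for w
  proof -
    obtain y z where yz: "y \<in> span N" "\<And>v. v \<in> span N \<Longrightarrow> orthogonal z v" "w = y + z"
      using orthogonal_subspace_decomp_exists[of N w] by blast
    have sp: "span N = N" using subN by simp
    have "y \<in> N" using yz(1) unfolding sp .
    then have y: "y \<in> V" "f y = 0" by (auto simp: N_def)
    have "z = w - y" using yz(3) by simp
    then have "z \<in> V" using assms(2) that y(1) by (simp add: subspace_diff)
    then have "z \<in> U" using yz(2) sp by (auto simp: U_def orthogonal_def inner_commute)
    then have "e * norm z \<le> norm (f z)" using e by blast
    moreover have "f z = f w" using \<open>z = w - y\<close> y(2) assms(1) by (simp add: linear_diff)
    ultimately have "norm (w - y) \<le> (1/e) * norm (f w)"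
      using e(1) \<open>z = w - y\<close> by (simp add: field_simps)
    then show ?thesis using y by blast
  qed
  then show ?thesis using e(1) by (intro exI[of _ "1/e"]) auto
qed

lemma self_adjoint_range:
  fixes H :: "'a::euclidean_space \<Rightarrow> 'a"
  assumes "linear H" and sa: "\<And>x y. H x \<bullet> y = x \<bullet> H y"
    and orth: "\<And>n. H n = 0 \<Longrightarrow> g \<bullet> n = 0"
  shows "\<exists>a. H a = g"
proof -
  have sp: "span (range H) = range H"
    using linear_subspace_image[OF assms(1) subspace_UNIV] by simp
  obtain y z where yz: "y \<in> span (range H)" "\<And>v. v \<in> span (range H) \<Longrightarrow> orthogonal z v" "g = y + z"
    using orthogonal_subspace_decomp_exists[of "range H" g] by blast
  have "H z \<bullet> H z = z \<bullet> H (H z)" by (rule sa)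
  also have "\<dots> = 0" using yz(2)[of "H (H z)"] sp by (auto simp: orthogonal_def)
  finally have "g \<bullet> z = 0" by (intro orth) simp
  moreover have "y \<bullet> z = 0" using yz(2)[OF yz(1)] by (simp add: orthogonal_def inner_commute)
  ultimately have "z = 0" using yz(3) by (simp add: inner_add_left)
  then show ?thesis using yz sp by auto
qed

text \<open>A preimage of g is only determined modulo the kernel of H. Choosing it so that Ba is orthogonal
  to B(ker H) removes the mixed term between a and the kernel component of w from Bw \<bullet> Ba,
  a term too large to be absorbed into the others.\<close>

lemma adapted_preimage:
  fixes H :: "'a::euclidean_space \<Rightarrow> 'a" and B :: "'a \<Rightarrow> 'b::euclidean_space"
  assumes "linear H" and "\<And>x y. H x \<bullet> y = x \<bullet> H y" and "linear B"
    and "\<And>n. H n = 0 \<Longrightarrow> g \<bullet> n = 0"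
  shows "\<exists>a. H a = g \<and> (\<forall>n. H n = 0 \<longrightarrow> B a \<bullet> B n = 0)"
proof -
  obtain a0 where a0: "H a0 = g" using self_adjoint_range[OF assms(1,2,4)] by blast
  define N where "N = {n. H n = 0}"
  have "subspace N"
    using assms(1) unfolding N_def subspace_def by (auto simp: linear_add linear_scale linear_0)
  then have sp: "span (B ` N) = B ` N"
    using linear_subspace_image[OF assms(3)] by simp
  obtain y z where yz: "y \<in> span (B ` N)" "\<And>v. v \<in> span (B ` N) \<Longrightarrow> orthogonal z v" "B a0 = y + z"
    using orthogonal_subspace_decomp_exists[of "B ` N" "B a0"] by blast
  have "y \<in> B ` N" using yz(1) unfolding sp .
  then obtain n where n: "H n = 0" "y = B n" by (auto simp: N_def)
  have "H (a0 - n) = g" using a0 n assms(1) by (simp add: linear_diff)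
  moreover have "B (a0 - n) \<bullet> B n' = 0" if "H n' = 0" for n'
  proof -
    have "B (a0 - n) = z" using yz(3) n assms(3) by (simp add: linear_diff)
    moreover have "B n' \<in> span (B ` N)" using that by (intro span_base) (simp add: N_def)
    ultimately show ?thesis using yz(2)[of "B n'"] by (simp add: orthogonal_def)
  qed
  ultimately show ?thesis by blast
qed

section \<open>Scalar inequalities between multiplier, residual and distance\<close>

lemma power2_add_le: "(s + t)\<^sup>2 \<le> 2 * (s\<^sup>2 + t\<^sup>2)" for s t :: real
  using zero_le_power2[of "s - t"] by (simp add: power2_eq_square algebra_simps)

lemma power4_add_le: "(s + t) ^ 4 \<le> 8 * (s ^ 4 + t ^ 4)" for s t :: real
proof -
  have "(s + t) ^ 4 = ((s + t)\<^sup>2)\<^sup>2" by simp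
  also have "\<dots> \<le> (2 * (s\<^sup>2 + t\<^sup>2))\<^sup>2" by (intro power_mono power2_add_le) simp
  also have "\<dots> = 4 * (s\<^sup>2 + t\<^sup>2)\<^sup>2" by (simp only: power_mult_distrib) simp
  also have "\<dots> \<le> 4 * (2 * ((s\<^sup>2)\<^sup>2 + (t\<^sup>2)\<^sup>2))" by (intro mult_left_mono power2_add_le) simp
  finally show ?thesis by simp
qed

text \<open>A residual bounded away from zero makes the Lojasiewicz inequality trivial for bounded F.\<close>

lemma cube_le_fourth_power_of_large:
  fixes F R r M :: real
  assumes "0 \<le> F" and "F \<le> M" and "0 < r" and "r \<le> R"
  shows "F ^ 3 \<le> (M ^ 3 / r ^ 4) * R ^ 4"
proof -
  have "F ^ 3 \<le> M ^ 3" using assms by (intro power_mono) auto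
  also have "\<dots> = (M ^ 3 / r ^ 4) * r ^ 4" using assms by simp
  also have "\<dots> \<le> (M ^ 3 / r ^ 4) * R ^ 4"
    using assms by (intro mult_left_mono power_mono) auto
  finally show ?thesis .
qed

text \<open>The source of the exponent 4/3: the value F is of order Rs with s of order R^(1/3).\<close>

lemma cube_le_fourth_power_of_small:
  fixes F R s C D :: real
  assumes "0 \<le> F" "F \<le> C * R * (R + s)" "s ^ 3 \<le> D * R" "0 \<le> R" "R \<le> 1" "0 \<le> s" "0 \<le> C"
  shows "F ^ 3 \<le> (C ^ 3 * 4 * (1 + D)) * R ^ 4"
proof -
  have "F ^ 3 \<le> (C * R * (R + s)) ^ 3" using assms by (intro power_mono) auto
  also have "\<dots> = C ^ 3 * R ^ 3 * (R + s) ^ 3" by (simp add: power_mult_distrib)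
  also have "\<dots> \<le> C ^ 3 * R ^ 3 * (4 * (1 + D) * R)"
  proof (intro mult_left_mono)
    have "0 \<le> 3 * (R + s) * (R - s)\<^sup>2" using assms by simp
    then have "(R + s) ^ 3 \<le> 4 * (R ^ 3 + s ^ 3)"
      by (simp add: power2_eq_square power3_eq_cube algebra_simps)
    also have "\<dots> \<le> 4 * (R + D * R)"
    proof -
      have "R ^ 3 \<le> R" using power_decreasing[of 1 3 R] assms by simp
      then show ?thesis using assms by simp
    qed
    finally show "(R + s) ^ 3 \<le> 4 * (1 + D) * R" by (simp add: algebra_simps)
  qed (use assms in auto)
  also have "\<dots> = (C ^ 3 * 4 * (1 + D)) * R ^ 4"
    by (simp add: power4_eq_xxxx power3_eq_cube)
  finally show ?thesis .
qed

text \<open>Here m stands for |\<mu>|, p for |Bw|, t for the length of the image under B of the kernel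
  component of w, and R for the residual. The hypotheses \<open>h3\<close> and \<open>h4\<close>
  say that m and p^2 agree up to constants and R. Together with \<open>h1\<close> and
  \<open>h2\<close> this makes mp, of order m^(3/2), at most of order R, whence m \<lesssim>
  R^(2/3) and p \<lesssim> R^(1/3).\<close>

lemma scalar_balance_transversal:
  fixes K m p t R :: real
  assumes "1 \<le> K" "0 \<le> m" "0 \<le> p" "0 \<le> t" "0 \<le> R" "m \<le> 1" "R \<le> 1" "4 * K ^ 3 * p \<le> 1"
    and h1: "m * t \<le> K * (R + m\<^sup>2 * p)"
    and h2: "p \<le> K * (t + R + m)"
    and h3: "m \<le> K * (p\<^sup>2 + R)"
    and h4: "p\<^sup>2 \<le> K * (m + R)"
  shows "m\<^sup>2 \<le> 4 * K ^ 3 * R * (p + m)" and "m * p \<le> 18 * K ^ 5 * R"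
    and "(p + m) ^ 3 \<le> 192 * K ^ 5 * R"
proof -
  have K1: "1 \<le> K ^ n" for n using assms(1) by (rule one_le_power)
  have Kle: "K ^ i \<le> K ^ j" if "i \<le> j" for i j using that assms(1) by (rule power_increasing)
  have p1: "p \<le> 1"
    using K1[of 3] assms(3,8) mult_right_mono[OF K1[of 3] assms(3)] by linarith
  have mp: "m * p \<le> 2 * K\<^sup>2 * (R + m\<^sup>2)"
  proof -
    have "m * p \<le> m * (K * (t + R + m))" using h2 assms by (intro mult_left_mono)
    also have "\<dots> = K * (m * t + m * R + m\<^sup>2)" by (simp add: algebra_simps power2_eq_square)
    also have "\<dots> \<le> K * (K * (R + m\<^sup>2) + K * (R + m\<^sup>2))"
    proof (intro mult_left_mono)
      have "m\<^sup>2 * p \<le> m\<^sup>2" using p1 by (simp add: mult_left_le)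
      then have "K * (R + m\<^sup>2 * p) \<le> K * (R + m\<^sup>2)" using assms by (intro mult_left_mono) auto
      have mR: "m * R \<le> R" using assms by (simp add: mult_left_le_one_le)
      have "1 * (R + m\<^sup>2) \<le> K * (R + m\<^sup>2)" using assms by (intro mult_right_mono) auto
      have "m * R + m\<^sup>2 \<le> 1 * (R + m\<^sup>2)" using mR by simp
      then have "m * R + m\<^sup>2 \<le> K * (R + m\<^sup>2)"
        using \<open>1 * (R + m\<^sup>2) \<le> K * (R + m\<^sup>2)\<close> by (rule order_trans)
      moreover have "m * t \<le> K * (R + m\<^sup>2)" using h1 \<open>K * (R + m\<^sup>2 * p) \<le> K * (R + m\<^sup>2)\<close>
        by (rule order_trans)
      ultimately show "m * t + m * R + m\<^sup>2 \<le> K * (R + m\<^sup>2) + K * (R + m\<^sup>2)"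
        by simp
    qed (use assms in auto)
    finally show ?thesis by (simp add: algebra_simps power2_eq_square)
  qed
  show m2: "m\<^sup>2 \<le> 4 * K ^ 3 * R * (p + m)"
  proof -
    have "m\<^sup>2 \<le> m * (K * (p\<^sup>2 + R))"
      unfolding power2_eq_square[of m] using h3 assms by (intro mult_left_mono)
    also have "\<dots> = K * (p * (m * p) + m * R)" by (simp add: algebra_simps power2_eq_square)
    also have "\<dots> \<le> K * (p * (2 * K\<^sup>2 * (R + m\<^sup>2)) + (2 * K\<^sup>2) * (m * R))"
    proof (intro mult_left_mono add_mono)
      have "1 \<le> 2 * K\<^sup>2" using K1[of 2] by linarith
      then have "1 * (m * R) \<le> (2 * K\<^sup>2) * (m * R)"
        using assms by (intro mult_right_mono) auto
      then show "m * R \<le> (2 * K\<^sup>2) * (m * R)" by simp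
    qed (use mp assms in auto)
    also have "\<dots> = 2 * K ^ 3 * R * (p + m) + m\<^sup>2 * (4 * K ^ 3 * p) / 2"
      by (simp add: algebra_simps power2_eq_square power3_eq_cube)
    also have "\<dots> \<le> 2 * K ^ 3 * R * (p + m) + m\<^sup>2 * 1 / 2"
      using assms by (intro add_mono divide_right_mono mult_left_mono) auto
    finally show ?thesis by simp
  qed
  show "m * p \<le> 18 * K ^ 5 * R"
  proof -
    have "4 * K ^ 3 * R * (p + m) \<le> 4 * K ^ 3 * R * 2"
      using p1 assms by (intro mult_left_mono) auto
    then have "R + m\<^sup>2 \<le> 1 * R + 8 * K ^ 3 * R" using m2 by linarith
    also have "\<dots> \<le> K ^ 3 * R + 8 * K ^ 3 * R"
      using K1[of 3] assms by (intro add_mono mult_right_mono) auto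
    finally have "R + m\<^sup>2 \<le> 9 * K ^ 3 * R" by linarith
    then have "2 * K\<^sup>2 * (R + m\<^sup>2) \<le> 2 * K\<^sup>2 * (9 * K ^ 3 * R)"
      by (intro mult_left_mono) auto
    also have "\<dots> = 18 * K ^ 5 * R" by (simp add: power_add[of K 2 3, simplified])
    finally show ?thesis using mp by linarith
  qed
  define s where "s = p + m"
  have s0: "0 \<le> s" using assms by (simp add: s_def)
  have q4: "s ^ 4 \<le> 96 * K ^ 5 * R * (s + R)"
  proof -
    have "s ^ 4 \<le> 8 * (p ^ 4 + m ^ 4)" unfolding s_def by (rule power4_add_le)
    also have "\<dots> = 8 * ((p\<^sup>2)\<^sup>2 + (m\<^sup>2)\<^sup>2)" by simp
    also have "\<dots> \<le> 8 * (K\<^sup>2 * (2 * (m\<^sup>2 + R\<^sup>2)) + K\<^sup>2 * m\<^sup>2)"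
    proof -
      have "(p\<^sup>2)\<^sup>2 \<le> (K * (m + R))\<^sup>2" using h4 by (intro power_mono) auto
      also have "\<dots> = K\<^sup>2 * (m + R)\<^sup>2" by (rule power_mult_distrib)
      also have "\<dots> \<le> K\<^sup>2 * (2 * (m\<^sup>2 + R\<^sup>2))" by (rule mult_left_mono[OF power2_add_le]) simp
      finally have a: "(p\<^sup>2)\<^sup>2 \<le> K\<^sup>2 * (2 * (m\<^sup>2 + R\<^sup>2))" .
      have "m\<^sup>2 \<le> 1" using assms by (simp add: power_le_one)
      then have "m\<^sup>2 \<le> K\<^sup>2" using K1[of 2] by linarith
      then have b: "(m\<^sup>2)\<^sup>2 \<le> K\<^sup>2 * m\<^sup>2"
        unfolding power2_eq_square[of "m\<^sup>2"] by (rule mult_right_mono) simp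
      show ?thesis by (intro mult_left_mono add_mono a b) simp_all
    qed
    also have "\<dots> \<le> 24 * K\<^sup>2 * (m\<^sup>2 + R\<^sup>2)"
    proof -
      have "0 \<le> K\<^sup>2 * R\<^sup>2" by simp
      then show ?thesis by (simp add: algebra_simps)
    qed
    also have "\<dots> \<le> 24 * K\<^sup>2 * (4 * K ^ 3 * R * s + 4 * K ^ 3 * R\<^sup>2)"
    proof (intro mult_left_mono add_mono)
      show "m\<^sup>2 \<le> 4 * K ^ 3 * R * s" using m2 by (simp add: s_def)
      have "1 \<le> 4 * K ^ 3" using K1[of 3] by linarith
      then have "1 * R\<^sup>2 \<le> 4 * K ^ 3 * R\<^sup>2" by (intro mult_right_mono) auto
      then show "R\<^sup>2 \<le> 4 * K ^ 3 * R\<^sup>2" by simp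
    qed (use assms in auto)
    also have "\<dots> = 96 * K ^ 5 * R * (s + R)"
      by (simp add: power_add[of K 2 3, simplified] algebra_simps power2_eq_square[of R])
    finally show ?thesis .
  qed
  show "(p + m) ^ 3 \<le> 192 * K ^ 5 * R"
  proof (cases "s \<le> R")
    case True
    have "s ^ 3 \<le> R ^ 3" using True s0 by (intro power_mono)
    also have "\<dots> \<le> R" using power_decreasing[of 1 3 R] assms by simp
    also have "R \<le> 192 * K ^ 5 * R"
    proof -
      have "1 \<le> 192 * K ^ 5" using K1[of 5] by linarith
      then have "1 * R \<le> 192 * K ^ 5 * R" using assms by (intro mult_right_mono) auto
      then show ?thesis by simp
    qed
    finally show ?thesis by (simp add: s_def)
  next
    case False
    then have sp: "0 < s" using assms by linarith
    have "96 * K ^ 5 * R * (s + R) \<le> 96 * K ^ 5 * R * (2 * s)"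
      using False assms by (intro mult_left_mono) auto
    then have "s ^ 4 \<le> (192 * K ^ 5 * R) * s" using q4 by linarith
    then have "s ^ 3 * s \<le> (192 * K ^ 5 * R) * s"
      by (simp add: power4_eq_xxxx power3_eq_cube)
    then show ?thesis using sp by (simp add: s_def)
  qed
qed

text \<open>With the linear term in \<mu> absent, \<open>e\<close> bounds p^2 and m^2c^2 directly by R, the
  right-hand side being absorbed for small arguments. If c = 0 there is no bound on m, but mp is
  still of order R by \<open>a\<close> and \<open>b\<close>. For c = 0 the default value 1/c^2 = 0
  keeps the stated constant meaningful.\<close>

lemma scalar_balance_tangential:
  fixes L c m p t R :: real
  assumes "1 \<le> L" "0 \<le> c" "0 \<le> m" "0 \<le> p" "0 \<le> t" "0 \<le> R" "m \<le> 1" "R \<le> 1"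
    and small: "2 * L\<^sup>2 * m \<le> 1" "c \<noteq> 0 \<Longrightarrow> 2 * L * p \<le> c"
    and a: "m * t \<le> L * (R + m\<^sup>2 * p)"
    and b: "p \<le> L * (t + R + m * c)"
    and e: "p\<^sup>2 / 2 + m\<^sup>2 * c\<^sup>2 \<le> L * (R + c * m * (m * p + R))"
  shows "p\<^sup>2 \<le> 2 * L * (1 + c) * R"
    and "m * p \<le> (4 * L\<^sup>2 + 2 * L * (1 + c) * (1 + 1 / c\<^sup>2)) * R"
proof (atomize(full), cases "c = 0")
  case True
  have "p\<^sup>2 \<le> 2 * L * (1 + c) * R" using e True by simp
  moreover have "m * p \<le> 4 * L\<^sup>2 * R"
  proof -
    have "m * p \<le> m * (L * (t + R))" using b True assms by (intro mult_left_mono) auto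
    also have "\<dots> = L * (m * t + m * R)" by (simp add: algebra_simps)
    also have "\<dots> \<le> L * (L * (R + m\<^sup>2 * p) + L * R)"
    proof (intro mult_left_mono add_mono)
      show "m * R \<le> L * R" using assms by (intro mult_right_mono) auto
    qed (use a assms in auto)
    also have "\<dots> = 2 * L\<^sup>2 * R + (2 * L\<^sup>2 * m) * (m * p) / 2"
      by (simp add: algebra_simps power2_eq_square)
    also have "\<dots> \<le> 2 * L\<^sup>2 * R + 1 * (m * p) / 2"
      using small assms by (intro add_mono divide_right_mono mult_right_mono) auto
    finally show ?thesis by simp
  qed
  moreover have "0 \<le> 2 * L * (1 + c) * (1 + 1 / c\<^sup>2) * R" using assms by simp
  ultimately show "p\<^sup>2 \<le> 2 * L * (1 + c) * R \<and>
      m * p \<le> (4 * L\<^sup>2 + 2 * L * (1 + c) * (1 + 1 / c\<^sup>2)) * R"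
    by (simp add: algebra_simps)
next
  case False
  then have c: "0 < c" using assms by simp
  have "L * (R + c * m * (m * p + R)) = L * R + c * m\<^sup>2 * (2 * L * p) / 2 + L * c * (m * R)"
    by (simp add: algebra_simps power2_eq_square)
  also have "\<dots> \<le> L * R + c * m\<^sup>2 * c / 2 + L * c * R"
    using small(2)[OF False] assms
    by (intro add_mono mult_left_mono divide_right_mono) (auto simp: mult_left_le_one_le)
  finally have "p\<^sup>2 / 2 + m\<^sup>2 * c\<^sup>2 \<le> L * R + c * m\<^sup>2 * c / 2 + L * c * R" using e by linarith
  then have *: "p\<^sup>2 + m\<^sup>2 * c\<^sup>2 \<le> 2 * L * (1 + c) * R"
    by (simp add: algebra_simps power2_eq_square)
  have "0 \<le> m\<^sup>2 * c\<^sup>2" by simp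
  then have p2: "p\<^sup>2 \<le> 2 * L * (1 + c) * R" using * by linarith
  have "0 \<le> p\<^sup>2" by simp
  then have "m\<^sup>2 * c\<^sup>2 \<le> 2 * L * (1 + c) * R" using * by linarith
  then have m2: "m\<^sup>2 \<le> 2 * L * (1 + c) * R * (1 / c\<^sup>2)"
    using c by (simp add: field_simps)
  have "2 * (m * p) \<le> m\<^sup>2 + p\<^sup>2" using sum_squares_bound[of m p] by simp
  moreover have "0 \<le> m * p" using assms by simp
  ultimately have "m * p \<le> m\<^sup>2 + p\<^sup>2" by linarith
  also have "\<dots> \<le> 2 * L * (1 + c) * R * (1 / c\<^sup>2) + 2 * L * (1 + c) * R"
    using m2 p2 by (rule add_mono)
  also have "\<dots> = 2 * L * (1 + c) * (1 + 1 / c\<^sup>2) * R" by (simp add: algebra_simps)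
  also have "\<dots> \<le> (4 * L\<^sup>2 + 2 * L * (1 + c) * (1 + 1 / c\<^sup>2)) * R"
    using assms by (intro mult_right_mono) auto
  finally show "p\<^sup>2 \<le> 2 * L * (1 + c) * R \<and>
      m * p \<le> (4 * L\<^sup>2 + 2 * L * (1 + c) * (1 + 1 / c\<^sup>2)) * R"
    using p2 by blast
qed

text \<open>Applied with p = |Bw|, c = |Ba| and \<tau> = u \<bullet> Ba, where Ha = B^T u. The number \<tau>
  decides how \<mu> and p = |Bw| are related by the constraint: for \<tau> \<noteq> 0 it forces
  p^2 \<approx> 2|\<mu>\<tau>|, for \<tau> = 0 only the nonnegative terms p^2/2 and \<mu>^2c^2
  remain, and each of them is bounded by the error.\<close>

lemma scalar_balance:
  fixes L c \<tau> :: real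
  assumes L: "1 \<le> L" and c: "0 \<le> c"
  shows "\<exists>C>0. \<exists>\<eta>>0. \<forall>\<mu> p t R F.
     \<bar>\<mu>\<bar> \<le> \<eta> \<and> 0 \<le> p \<and> p \<le> \<eta> \<and> 0 \<le> t \<and> 0 \<le> R \<and> R \<le> \<eta> \<and>
     \<bar>\<mu>\<bar> * t \<le> L * (R + \<bar>\<mu>\<bar>\<^sup>2 * p) \<and>
     p \<le> L * (t + R + \<bar>\<mu>\<bar> * c) \<and>
     \<bar>p\<^sup>2 / 2 + \<mu> * \<tau> + \<mu>\<^sup>2 * c\<^sup>2\<bar> \<le> L * (R + c * \<bar>\<mu>\<bar> * (\<bar>\<mu>\<bar> * p + R)) \<and>
     0 \<le> F \<and> F \<le> L * (\<bar>\<mu>\<bar> * p + R)\<^sup>2 + \<bar>\<mu>\<bar> * p\<^sup>2 + \<bar>\<mu>\<bar>\<^sup>2 * \<bar>\<tau>\<bar>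
     \<longrightarrow> F ^ 3 \<le> C * R ^ 4"
proof (cases "\<tau> = 0")
  case True
  define C1 where "C1 = 4 * L\<^sup>2 + 2 * L * (1 + c) * (1 + 1 / c\<^sup>2)"
  define D where "D = 2 * L * (1 + c)"
  define C2 where "C2 = L * (C1 + 1)\<^sup>2 + C1"
  define \<eta> where "\<eta> = min 1 (min (1 / (2 * L\<^sup>2)) (if c = 0 then 1 else c / (2 * L)))"
  have C10: "0 \<le> C1" and D0: "0 \<le> D" using L c by (auto simp: C1_def D_def)
  have C20: "0 \<le> C2" using L C10 by (simp add: C2_def)
  have \<eta>: "0 < \<eta>" using L c by (simp add: \<eta>_def)
  show ?thesis
  proof (rule exI[of _ "C2 ^ 3 * 4 * (1 + D) + 1"], intro conjI exI[of _ \<eta>] allI impI; (elim conjE)?)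
    fix \<mu> p t R F :: real
    assume h: "\<bar>\<mu>\<bar> \<le> \<eta>" "0 \<le> p" "p \<le> \<eta>" "0 \<le> t" "0 \<le> R" "R \<le> \<eta>"
     "\<bar>\<mu>\<bar> * t \<le> L * (R + \<bar>\<mu>\<bar>\<^sup>2 * p)"
     "p \<le> L * (t + R + \<bar>\<mu>\<bar> * c)"
     "\<bar>p\<^sup>2 / 2 + \<mu> * \<tau> + \<mu>\<^sup>2 * c\<^sup>2\<bar> \<le> L * (R + c * \<bar>\<mu>\<bar> * (\<bar>\<mu>\<bar> * p + R))"
     "0 \<le> F" "F \<le> L * (\<bar>\<mu>\<bar> * p + R)\<^sup>2 + \<bar>\<mu>\<bar> * p\<^sup>2 + \<bar>\<mu>\<bar>\<^sup>2 * \<bar>\<tau>\<bar>"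
    have small: "2 * L\<^sup>2 * \<bar>\<mu>\<bar> \<le> 1"
    proof -
      have "\<bar>\<mu>\<bar> \<le> 1 / (2 * L\<^sup>2)" using h(1) by (simp add: \<eta>_def)
      then show ?thesis using L by (simp add: field_simps)
    qed
    have small': "2 * L * p \<le> c" if "c \<noteq> 0"
    proof -
      have "p \<le> c / (2 * L)" using h(3) that by (simp add: \<eta>_def)
      then show ?thesis using L by (simp add: field_simps)
    qed
    have e: "p\<^sup>2 / 2 + \<bar>\<mu>\<bar>\<^sup>2 * c\<^sup>2 \<le> L * (R + c * \<bar>\<mu>\<bar> * (\<bar>\<mu>\<bar> * p + R))"
      using h(9) True by simp
    have le1: "\<bar>\<mu>\<bar> \<le> 1" "p \<le> 1" "R \<le> 1" using h(1,3,6) by (auto simp: \<eta>_def)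
    note T = scalar_balance_tangential[OF L c abs_ge_zero h(2,4,5) le1(1,3) small small' h(7,8) e]
    have p2: "p\<^sup>2 \<le> D * R" using T(1) by (simp add: D_def)
    have mp: "\<bar>\<mu>\<bar> * p \<le> C1 * R" using T(2) by (simp add: C1_def)
    have p3: "p ^ 3 \<le> D * R"
      using p2 power_decreasing[of 2 3 p] le1 h(2,4,5) by auto
    have "F \<le> L * (\<bar>\<mu>\<bar> * p + R)\<^sup>2 + p * (\<bar>\<mu>\<bar> * p)"
      using h(11) True by (simp add: power2_eq_square algebra_simps)
    also have "\<dots> \<le> L * (C1 * R + R)\<^sup>2 + p * (C1 * R)"
      using mp L h(2,4,5) by (intro add_mono mult_left_mono power_mono) auto
    also have "\<dots> = L * (C1 + 1)\<^sup>2 * (R * R) + C1 * (R * p)"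
      by (simp add: power2_eq_square algebra_simps)
    also have "\<dots> \<le> C2 * (R * R) + C2 * (R * p)"
      using L C10 h(2,4,5) by (intro add_mono mult_right_mono) (auto simp: C2_def)
    also have "\<dots> = C2 * R * (R + p)" by (simp add: algebra_simps)
    finally have "F \<le> C2 * R * (R + p)" .
    then have "F ^ 3 \<le> (C2 ^ 3 * 4 * (1 + D)) * R ^ 4"
      by (rule cube_le_fourth_power_of_small[OF h(10) _ p3 h(5) le1(3) h(2) C20])
    then show "F ^ 3 \<le> (C2 ^ 3 * 4 * (1 + D) + 1) * R ^ 4"
      using zero_le_power[OF h(5), of 4] unfolding distrib_right by linarith
  qed (use C20 D0 \<eta> in \<open>auto intro!: add_nonneg_pos\<close>)
next
  case False
  define T where "T = \<bar>\<tau>\<bar>"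
  have T0: "0 < T" using False by (simp add: T_def)
  define K where "K = L * (1 + c) + 3 * T + 2 * L + 2 * L / T + 1 / T"
  define C1 where "C1 = 18 * K ^ 5"
  define D where "D = 192 * K ^ 5"
  define C2 where "C2 = L * (C1 + 1)\<^sup>2 + C1 + T * (4 * K ^ 3)"
  define \<eta> where "\<eta> = min 1 (min (1 / (4 * K ^ 3)) (T / (4 * (c\<^sup>2 + 2 * L * c + 1))))"
  have pos: "0 \<le> L * c" "0 \<le> L / T" "0 \<le> 1 / T" "0 \<le> c\<^sup>2" using L c T0 by auto
  have Kge: "1 \<le> K" "L \<le> K" "L * (1 + c) \<le> K" "3 * T \<le> K" "2 * L \<le> K" "2 * L / T \<le> K" "1 / T \<le> K"
    using pos L c T0 unfolding K_def distrib_left mult_1_right by linarith+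
  have K3: "0 < K ^ 3" using Kge by simp
  have C10: "0 \<le> C1" and D0: "0 \<le> D" using Kge by (auto simp: C1_def D_def)
  have C20: "0 \<le> C2" using L C10 T0 K3 by (simp add: C2_def)
  have q: "0 < c\<^sup>2 + 2 * L * c + 1" using pos by linarith
  have \<eta>: "0 < \<eta>"
    unfolding \<eta>_def min_less_iff_conj using K3 T0 q by (intro conjI divide_pos_pos mult_pos_pos) auto
  show ?thesis
  proof (rule exI[of _ "C2 ^ 3 * 4 * (1 + D) + 1"], intro conjI exI[of _ \<eta>] allI impI; (elim conjE)?)
    fix \<mu> p t R F :: real
    assume h: "\<bar>\<mu>\<bar> \<le> \<eta>" "0 \<le> p" "p \<le> \<eta>" "0 \<le> t" "0 \<le> R" "R \<le> \<eta>"
     "\<bar>\<mu>\<bar> * t \<le> L * (R + \<bar>\<mu>\<bar>\<^sup>2 * p)"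
     "p \<le> L * (t + R + \<bar>\<mu>\<bar> * c)"
     "\<bar>p\<^sup>2 / 2 + \<mu> * \<tau> + \<mu>\<^sup>2 * c\<^sup>2\<bar> \<le> L * (R + c * \<bar>\<mu>\<bar> * (\<bar>\<mu>\<bar> * p + R))"
     "0 \<le> F" "F \<le> L * (\<bar>\<mu>\<bar> * p + R)\<^sup>2 + \<bar>\<mu>\<bar> * p\<^sup>2 + \<bar>\<mu>\<bar>\<^sup>2 * \<bar>\<tau>\<bar>"
    define m where "m = \<bar>\<mu>\<bar>"
    have m0: "0 \<le> m" and m2: "\<mu>\<^sup>2 = m\<^sup>2" by (auto simp: m_def)
    have le1: "m \<le> 1" "p \<le> 1" "R \<le> 1" using h(1,3,6) by (auto simp: \<eta>_def m_def)
    have small: "4 * K ^ 3 * p \<le> 1"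
    proof -
      have "p \<le> 1 / (4 * K ^ 3)" using h(3) by (simp add: \<eta>_def)
      then show ?thesis using K3 by (simp add: field_simps)
    qed
    have E: "c\<^sup>2 * m\<^sup>2 + L * c * m * (m * p + R) \<le> m * T / 4"
    proof -
      have "m * p \<le> m" using m0 le1 by (simp add: mult_left_le)
      then have "m * p + R \<le> 2 * \<eta>" using h(1,6) by (simp add: m_def)
      then have "L * c * m * (m * p + R) \<le> L * c * m * (2 * \<eta>)"
        using L c m0 by (intro mult_left_mono) auto
      moreover have "c\<^sup>2 * m\<^sup>2 \<le> c\<^sup>2 * (m * \<eta>)"
      proof -
        have "m * m \<le> m * \<eta>" using h(1) m0 unfolding m_def[symmetric] by (rule mult_left_mono)
        then show ?thesis unfolding power2_eq_square[of m] by (rule mult_left_mono) simp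
      qed
      ultimately have "c\<^sup>2 * m\<^sup>2 + L * c * m * (m * p + R) \<le> m * (\<eta> * (c\<^sup>2 + 2 * L * c))"
        by (simp add: algebra_simps)
      also have "\<dots> \<le> m * (\<eta> * (c\<^sup>2 + 2 * L * c + 1))"
        using m0 \<eta> by (intro mult_left_mono) auto
      also have "\<dots> \<le> m * (T / 4)"
      proof (intro mult_left_mono m0)
        have "\<eta> \<le> T / (4 * (c\<^sup>2 + 2 * L * c + 1))" by (simp add: \<eta>_def)
        then have "\<eta> * (c\<^sup>2 + 2 * L * c + 1) \<le> T / (4 * (c\<^sup>2 + 2 * L * c + 1)) * (c\<^sup>2 + 2 * L * c + 1)"
          using q by (intro mult_right_mono) auto
        moreover have "T / (4 * Q) * Q = T / 4" if "0 < Q" for Q using that by simp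
        note this[OF q]
        ultimately show "\<eta> * (c\<^sup>2 + 2 * L * c + 1) \<le> T / 4" by linarith
      qed
      finally show ?thesis by simp
    qed
    have eqs: "L * (R + c * m * (m * p + R)) = L * R + L * c * m * (m * p + R)"
      by (simp add: algebra_simps)
    have mT: "\<bar>\<mu> * \<tau>\<bar> = m * T" by (simp add: m_def T_def abs_mult)
    have c9: "\<bar>p\<^sup>2 / 2 + \<mu> * \<tau> + c\<^sup>2 * m\<^sup>2\<bar> \<le> L * R + L * c * m * (m * p + R)"
      using h(9) unfolding m2 m_def[symmetric] eqs by (simp add: mult.commute)
    have nn: "0 \<le> c\<^sup>2 * m\<^sup>2" "0 \<le> p\<^sup>2" by auto
    have LR: "0 \<le> L * R" "0 \<le> m * T" using L h(5) m0 T0 by auto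
    have "m * T \<le> p\<^sup>2 / 2 + L * R + m * T / 4"
      using c9 E nn unfolding mT[symmetric] by linarith
    then have up: "m * T \<le> p\<^sup>2 + 2 * L * R" using nn LR by linarith
    have h3: "m \<le> K * (p\<^sup>2 + R)"
    proof -
      have "m \<le> (p\<^sup>2 + 2 * L * R) / T" using up T0 by (simp add: field_simps)
      also have "\<dots> = 1 / T * p\<^sup>2 + 2 * L / T * R" by (simp add: add_divide_distrib)
      also have "\<dots> \<le> K * p\<^sup>2 + K * R"
        using Kge(6,7) pos h(5) by (intro add_mono mult_right_mono) auto
      finally show ?thesis by (simp add: algebra_simps)
    qed
    have "p\<^sup>2 / 2 \<le> m * T + L * R + m * T / 4"
      using c9 E nn unfolding mT[symmetric] by linarith
    then have "p\<^sup>2 \<le> 3 * (m * T) + 2 * (L * R)" using LR by linarith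
    also have "\<dots> = (3 * T) * m + (2 * L) * R" by simp
    also have "\<dots> \<le> K * m + K * R"
      using Kge(4,5) L T0 m0 h(5) by (intro add_mono mult_right_mono) auto
    finally have h4: "p\<^sup>2 \<le> K * (m + R)" by (simp add: algebra_simps)
    have h1: "m * t \<le> K * (R + m\<^sup>2 * p)"
    proof -
      have "L * (R + m\<^sup>2 * p) \<le> K * (R + m\<^sup>2 * p)"
        using Kge(2) h(2,4,5) by (intro mult_right_mono) auto
      then show ?thesis using h(7) by (simp add: m_def)
    qed
    have h2: "p \<le> K * (t + R + m)"
    proof -
      have "0 \<le> c * (t + R)" using c h(2,4,5) by simp
      then have "t + R + m * c \<le> (1 + c) * (t + R + m)" using m0
        by (simp add: algebra_simps)
      then have "L * (t + R + m * c) \<le> L * ((1 + c) * (t + R + m))" using L by (intro mult_left_mono) auto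
      moreover have "(L * (1 + c)) * (t + R + m) \<le> K * (t + R + m)"
        using Kge(3) h(2,4,5) m0 by (intro mult_right_mono) auto
      ultimately show ?thesis using h(8) by (simp add: m_def mult.assoc)
    qed
    note T = scalar_balance_transversal[OF Kge(1) m0 h(2,4,5) le1(1,3) small h1 h2 h3 h4]
    define s where "s = p + m"
    have s0: "0 \<le> s" "p \<le> s" using m0 h(2,4,5) by (auto simp: s_def)
    have s3: "s ^ 3 \<le> D * R" using T(3) by (simp add: D_def s_def)
    have mp: "m * p \<le> C1 * R" using T(2) by (simp add: C1_def)
    have mm: "m\<^sup>2 \<le> 4 * K ^ 3 * R * s" using T(1) by (simp add: s_def)
    have "F \<le> L * (m * p + R)\<^sup>2 + p * (m * p) + m\<^sup>2 * T"
      using h(11) by (simp add: power2_eq_square algebra_simps m_def T_def)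
    also have "\<dots> \<le> L * (C1 * R + R)\<^sup>2 + s * (C1 * R) + (4 * K ^ 3 * R * s) * T"
    proof (intro add_mono)
      show "L * (m * p + R)\<^sup>2 \<le> L * (C1 * R + R)\<^sup>2"
        using mp L h(2,4,5) m0 by (intro mult_left_mono power_mono) auto
      show "p * (m * p) \<le> s * (C1 * R)"
        using m0 h(2) by (intro mult_mono[OF s0(2) mp s0(1)]) simp
      show "m\<^sup>2 * T \<le> (4 * K ^ 3 * R * s) * T"
        using mm T0 by (intro mult_right_mono) auto
    qed
    also have "\<dots> = L * (C1 + 1)\<^sup>2 * (R * R) + (C1 + T * (4 * K ^ 3)) * (R * s)"
      by (simp add: power2_eq_square algebra_simps)
    also have "\<dots> \<le> C2 * (R * R) + C2 * (R * s)"
      using L C10 h(2,4,5) T0 K3 s0 by (intro add_mono mult_right_mono) (auto simp: C2_def)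
    also have "\<dots> = C2 * R * (R + s)" by (simp add: algebra_simps)
    finally have "F \<le> C2 * R * (R + s)" .
    then have "F ^ 3 \<le> (C2 ^ 3 * 4 * (1 + D)) * R ^ 4"
      by (rule cube_le_fourth_power_of_small[OF h(10) _ s3 h(5) le1(3) s0(1) C20])
    then show "F ^ 3 \<le> (C2 ^ 3 * 4 * (1 + D) + 1) * R ^ 4"
      using zero_le_power[OF h(5), of 4] unfolding distrib_right by linarith
  qed (use C20 D0 \<eta> in \<open>auto intro!: add_nonneg_pos\<close>)
qed

section \<open>Lojasiewicz inequalities for quadratic functions\<close>

text \<open>With w' = w - \<mu> a the multiplier equation becomes Hw' = \<mu> B^T B w + \<rho>, so that w'
  is n_0 + n_1 + y with n_0, n_1 in the kernel of H, Bn_0 = 0, |n_1| controlled by t = |Bn_1| and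
  y of order |\<mu>||Bw| + R. The scalar relations come from testing the equation with n_1 and
  with a, from the triangle inequality for Bw = Bn_1 + By + \<mu> Ba, and from expanding w
  \<bullet> Hw in terms of w'.\<close>

lemma quadric_critical_reduction:
  fixes H :: "'a::euclidean_space \<Rightarrow> 'a" and B :: "'a \<Rightarrow> 'b::euclidean_space"
    and u :: 'b and w a :: 'a and \<mu> R K :: real
  assumes linH: "linear H" and sa: "\<And>x y. H x \<bullet> y = x \<bullet> H y" and linB: "linear B"
    and K1: "1 \<le> K" and kB: "\<And>x. norm (B x) \<le> K * norm x"
    and CH: "\<And>w. \<exists>n. H n = 0 \<and> norm (w - n) \<le> K * norm (H w)"
    and CB: "\<And>n. H n = 0 \<Longrightarrow> \<exists>n0. H n0 = 0 \<and> B n0 = 0 \<and> norm (n - n0) \<le> K * norm (B n)"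
    and Ha: "\<And>d. H a \<bullet> d = u \<bullet> B d" and orth: "\<And>n. H n = 0 \<Longrightarrow> B a \<bullet> B n = 0"
    and aK: "norm a \<le> K"
    and quad: "(norm (B w))\<^sup>2 + 2 * (u \<bullet> B w) = 0"
    and res: "\<And>d. \<bar>H w \<bullet> d - \<mu> * ((u + B w) \<bullet> B d)\<bar> \<le> R * norm d"
    and R0: "0 \<le> R" and small: "2 * K ^ 3 * \<bar>\<mu>\<bar> \<le> 1"
  shows "\<exists>t\<ge>0. \<bar>\<mu>\<bar> * t \<le> 2 * K ^ 3 * (R + \<bar>\<mu>\<bar>\<^sup>2 * norm (B w)) \<and>
     norm (B w) \<le> 2 * K ^ 3 * (t + R + \<bar>\<mu>\<bar> * norm (B a)) \<and>
     \<bar>(norm (B w))\<^sup>2 / 2 + \<mu> * (u \<bullet> B a) + \<mu>\<^sup>2 * (norm (B a))\<^sup>2\<bar>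
       \<le> 2 * K ^ 3 * (R + norm (B a) * \<bar>\<mu>\<bar> * (\<bar>\<mu>\<bar> * norm (B w) + R)) \<and>
     \<bar>H w \<bullet> w\<bar> \<le> 2 * K ^ 3 * (\<bar>\<mu>\<bar> * norm (B w) + R)\<^sup>2 + \<bar>\<mu>\<bar> * (norm (B w))\<^sup>2
       + \<bar>\<mu>\<bar>\<^sup>2 * \<bar>u \<bullet> B a\<bar>"
proof -
  define m where "m = \<bar>\<mu>\<bar>"
  define p where "p = norm (B w)"
  define c where "c = norm (B a)"
  define \<tau> where "\<tau> = u \<bullet> B a"
  have m0: "0 \<le> m" and p0: "0 \<le> p" and c0: "0 \<le> c" by (auto simp: m_def p_def c_def)
  have Kpow: "1 \<le> K ^ n" for n using K1 by (rule one_le_power)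
  have mp0: "0 \<le> m * p + R" using m0 p0 R0 by simp
  have K3: "K * K\<^sup>2 = K ^ 3" "K\<^sup>2 * K = K ^ 3" by (simp_all add: power2_eq_square power3_eq_cube)
  have KleK3: "K \<le> K ^ 3" using power_increasing[of 1 3 K] K1 by simp
  define w' where "w' = w - \<mu> *\<^sub>R a"
  have Hw': "H w' = H w - \<mu> *\<^sub>R H a" using linH by (simp add: w'_def linear_diff linear_scale)
  have res': "\<bar>H w' \<bullet> d - \<mu> * (B w \<bullet> B d)\<bar> \<le> R * norm d" for d
    using res[of d] by (simp add: Hw' Ha inner_diff_left inner_add_left algebra_simps)
  have nHw': "norm (H w') \<le> K * (m * p) + R"
  proof (cases "H w' = 0")
    case True then show ?thesis using K1 m0 p0 R0 by simp
  next
    case False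
    have "\<bar>B w \<bullet> B (H w')\<bar> \<le> norm (B w) * norm (B (H w'))" by (rule Cauchy_Schwarz_ineq2)
    also have "\<dots> \<le> p * (K * norm (H w'))"
      using kB[of "H w'"] by (simp add: p_def mult_left_mono)
    finally have "m * \<bar>B w \<bullet> B (H w')\<bar> \<le> m * (p * (K * norm (H w')))"
      using m0 by (rule mult_left_mono)
    then have "\<bar>\<mu> * (B w \<bullet> B (H w'))\<bar> \<le> K * (m * p) * norm (H w')"
      by (simp add: m_def abs_mult mult_ac)
    then have "H w' \<bullet> H w' \<le> R * norm (H w') + K * (m * p) * norm (H w')"
      using res'[of "H w'"] by linarith
    then have "norm (H w') * norm (H w') \<le> (K * (m * p) + R) * norm (H w')"
      by (simp add: dot_square_norm power2_eq_square algebra_simps)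
    then show ?thesis using False by simp
  qed
  have nHw'': "norm (H w') \<le> K * (m * p + R)"
    using nHw' mult_right_mono[OF K1 R0] by (simp add: algebra_simps)
  obtain n where n: "H n = 0" "norm (w' - n) \<le> K * norm (H w')" using CH by blast
  define y where "y = w' - n"
  have ny: "norm y \<le> K\<^sup>2 * (m * p + R)"
  proof -
    have "norm y \<le> K * (K * (m * p + R))"
      using n(2) mult_left_mono[OF nHw'', of K] K1 unfolding y_def by linarith
    then show ?thesis by (simp add: power2_eq_square mult.assoc)
  qed
  have nBy: "norm (B y) \<le> K ^ 3 * (m * p + R)"
  proof -
    have "norm (B y) \<le> K * (K\<^sup>2 * (m * p + R))"
      using kB[of y] mult_left_mono[OF ny, of K] K1 by linarith
    then show ?thesis by (simp add: K3(1) mult.assoc[symmetric])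
  qed
  obtain n0 where n0: "H n0 = 0" "B n0 = 0" "norm (n - n0) \<le> K * norm (B n)"
    using CB[OF n(1)] by blast
  define n1 where "n1 = n - n0"
  have Hn1: "H n1 = 0" using n(1) n0(1) linH by (simp add: n1_def linear_diff)
  have Bn1: "B n1 = B n" using n0(2) linB by (simp add: n1_def linear_diff)
  define t where "t = norm (B n1)"
  have t0: "0 \<le> t" by (simp add: t_def)
  have nn1: "norm n1 \<le> K * t" using n0(3) by (simp add: t_def Bn1) (simp add: n1_def)
  have Bw: "B w = B n1 + B y + \<mu> *\<^sub>R B a"
  proof -
    have "w = n + y + \<mu> *\<^sub>R a" by (simp add: y_def w'_def)
    then show ?thesis using linB by (simp add: Bn1 linear_add linear_scale)
  qed
  have am: "m * t \<le> 2 * K ^ 3 * (R + m\<^sup>2 * p)"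
  proof (cases "t = 0")
    case True then show ?thesis using K1 R0 p0 by simp
  next
    case False
    have "H w \<bullet> n1 = 0" using sa[of w n1] Hn1 by simp
    moreover have "u \<bullet> B n1 = 0" using Ha[of n1] sa[of a n1] Hn1 by simp
    ultimately have "\<bar>\<mu> * (B w \<bullet> B n1)\<bar> \<le> R * norm n1"
      using res[of n1] by (simp add: inner_add_left)
    also have "\<dots> \<le> R * (K * t)" using nn1 R0 by (rule mult_left_mono)
    finally have 1: "m * \<bar>B w \<bullet> B n1\<bar> \<le> R * (K * t)" by (simp add: m_def abs_mult)
    have "B w \<bullet> B n1 = t * t + B y \<bullet> B n1"
      using orth[OF Hn1] by (simp add: Bw inner_add_left t_def dot_square_norm power2_eq_square)
    moreover have "\<bar>B y \<bullet> B n1\<bar> \<le> norm (B y) * t" unfolding t_def by (rule Cauchy_Schwarz_ineq2)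
    ultimately have "t * t \<le> \<bar>B w \<bullet> B n1\<bar> + norm (B y) * t" by linarith
    then have "m * (t * t) \<le> m * (\<bar>B w \<bullet> B n1\<bar> + norm (B y) * t)" using m0 by (rule mult_left_mono)
    then have "m * (t * t) \<le> R * (K * t) + m * (norm (B y) * t)" using 1 by (simp add: distrib_left)
    then have "(m * t) * t \<le> (K * R + m * norm (B y)) * t" by (simp add: algebra_simps)
    then have "m * t \<le> K * R + m * norm (B y)" using False t0 by simp
    also have "\<dots> \<le> K ^ 3 * R + m * (K ^ 3 * (m * p + R))"
      using KleK3 R0 nBy m0 by (intro add_mono mult_right_mono mult_left_mono)
    also have "\<dots> = K ^ 3 * R + K ^ 3 * m\<^sup>2 * p + K ^ 3 * (m * R)"
      by (simp add: algebra_simps power2_eq_square)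
    also have "\<dots> \<le> K ^ 3 * R + 2 * (K ^ 3 * m\<^sup>2 * p) + K ^ 3 * R"
    proof -
      have "1 * m \<le> 2 * K ^ 3 * m" using Kpow[of 3] m0 by (intro mult_right_mono) linarith+
      then have "m \<le> 1" using small by (simp add: m_def)
      then have "m * R \<le> 1 * R" using R0 by (rule mult_right_mono)
      then have "K ^ 3 * (m * R) \<le> K ^ 3 * R" using K1 by (intro mult_left_mono) auto
      moreover have "0 \<le> K ^ 3 * m\<^sup>2 * p" using K1 p0 by simp
      ultimately show ?thesis by linarith
    qed
    finally show ?thesis by (simp add: algebra_simps)
  qed
  have bm: "p \<le> 2 * K ^ 3 * (t + R + m * c)"
  proof -
    have "p \<le> norm (B n1 + B y) + norm (\<mu> *\<^sub>R B a)" unfolding p_def Bw by (rule norm_triangle_ineq)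
    also have "\<dots> \<le> t + norm (B y) + m * c"
      using norm_triangle_ineq[of "B n1" "B y"] by (simp add: t_def m_def c_def)
    finally have "p \<le> t + K ^ 3 * (m * p + R) + m * c" using nBy by linarith
    moreover have "2 * (K ^ 3 * (m * p)) \<le> 1 * p"
      using mult_right_mono[OF small p0] by (simp add: m_def mult_ac)
    ultimately have "p \<le> 2 * t + 2 * K ^ 3 * R + 2 * (m * c)" by (simp add: distrib_left)
    moreover have "1 * t \<le> K ^ 3 * t" "1 * (m * c) \<le> K ^ 3 * (m * c)"
      using t0 m0 c0 by (intro mult_right_mono[OF Kpow]; simp)+
    ultimately show ?thesis unfolding distrib_left by linarith
  qed
  have uBw: "u \<bullet> B w = - p\<^sup>2 / 2" using quad by (simp add: p_def)
  have Hwa: "H w \<bullet> a = - p\<^sup>2 / 2"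
    using sa[of w a] Ha[of w] uBw by (simp add: inner_commute)
  have cm: "\<bar>p\<^sup>2 / 2 + \<mu> * \<tau> + \<mu>\<^sup>2 * c\<^sup>2\<bar> \<le> 2 * K ^ 3 * (R + c * m * (m * p + R))"
  proof -
    have "B w \<bullet> B a = B y \<bullet> B a + \<mu> * c\<^sup>2"
      using orth[OF Hn1] by (simp add: Bw inner_add_left c_def power2_norm_eq_inner inner_commute[of "B n1"])
    then have "\<mu> * ((u + B w) \<bullet> B a) = \<mu> * \<tau> + \<mu> * (B y \<bullet> B a) + \<mu>\<^sup>2 * c\<^sup>2"
      by (simp add: inner_add_left \<tau>_def algebra_simps power2_eq_square)
    then have "\<bar>p\<^sup>2 / 2 + \<mu> * \<tau> + \<mu>\<^sup>2 * c\<^sup>2 + \<mu> * (B y \<bullet> B a)\<bar> \<le> R * norm a"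
      using res[of a] Hwa by simp
    moreover have "R * norm a \<le> K ^ 3 * R"
      using mult_left_mono[OF aK R0] mult_right_mono[OF KleK3 R0] by (simp add: mult.commute)
    moreover have "\<bar>\<mu> * (B y \<bullet> B a)\<bar> \<le> K ^ 3 * (c * m * (m * p + R))"
    proof -
      have "\<bar>\<mu> * (B y \<bullet> B a)\<bar> \<le> m * (norm (B y) * c)"
        unfolding abs_mult m_def c_def by (intro mult_left_mono Cauchy_Schwarz_ineq2) simp
      also have "\<dots> \<le> m * (K ^ 3 * (m * p + R) * c)"
        using nBy m0 c0 by (intro mult_left_mono mult_right_mono)
      finally show ?thesis by (simp add: mult_ac)
    qed
    ultimately have "\<bar>p\<^sup>2 / 2 + \<mu> * \<tau> + \<mu>\<^sup>2 * c\<^sup>2\<bar> \<le> K ^ 3 * R + K ^ 3 * (c * m * (m * p + R))"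
      by linarith
    moreover have "0 \<le> K ^ 3 * R + K ^ 3 * (c * m * (m * p + R))"
      using K1 R0 mp0 c0 m0 by simp
    ultimately show ?thesis unfolding distrib_left mult.assoc by linarith
  qed
  have dm: "\<bar>H w \<bullet> w\<bar> \<le> 2 * K ^ 3 * (m * p + R)\<^sup>2 + m * p\<^sup>2 + m\<^sup>2 * \<bar>\<tau>\<bar>"
  proof -
    have "H w' \<bullet> a = u \<bullet> B w - \<mu> * \<tau>"
      using sa[of w' a] Ha[of w'] linB
      by (simp add: inner_commute w'_def linear_diff linear_scale inner_diff_right \<tau>_def)
    then have Hw'a: "H w' \<bullet> a = - p\<^sup>2 / 2 - \<mu> * \<tau>" using uBw by simp
    have "H w \<bullet> w = H w' \<bullet> w + \<mu> * (H a \<bullet> w)" by (simp add: Hw' inner_diff_left)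
    also have "H a \<bullet> w = - p\<^sup>2 / 2" using Ha[of w] uBw by simp
    also have "H w' \<bullet> w = H w' \<bullet> w' + \<mu> * (H w' \<bullet> a)" by (simp add: w'_def inner_diff_right)
    finally have "H w \<bullet> w = H w' \<bullet> w' - \<mu> * p\<^sup>2 - \<mu>\<^sup>2 * \<tau>"
      unfolding Hw'a by (simp add: algebra_simps power2_eq_square)
    moreover have "\<bar>\<mu> * p\<^sup>2\<bar> = m * p\<^sup>2" "\<bar>\<mu>\<^sup>2 * \<tau>\<bar> = m\<^sup>2 * \<bar>\<tau>\<bar>"
      by (simp_all add: m_def abs_mult)
    moreover have "\<bar>H w' \<bullet> w'\<bar> \<le> K ^ 3 * (m * p + R)\<^sup>2"
    proof -
      have "H w' \<bullet> n = 0" using sa[of w' n] n(1) by simp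
      then have "H w' \<bullet> w' = H w' \<bullet> y" by (simp add: y_def inner_diff_right)
      then have "\<bar>H w' \<bullet> w'\<bar> \<le> norm (H w') * norm y" by (simp add: Cauchy_Schwarz_ineq2)
      also have "\<dots> \<le> (K * (m * p + R)) * (K\<^sup>2 * (m * p + R))"
        using nHw'' ny K1 mp0 by (intro mult_mono) auto
      also have "\<dots> = K ^ 3 * (m * p + R)\<^sup>2"
        unfolding K3(1)[symmetric] power2_eq_square[of "m * p + R"] by (simp only: mult_ac)
      finally show ?thesis .
    qed
    moreover have "0 \<le> K ^ 3 * (m * p + R)\<^sup>2" using K1 by simp
    ultimately show ?thesis by linarith
  qed
  show ?thesis
    using t0 am bm cm dm unfolding m_def p_def c_def \<tau>_def by (intro exI[of _ t] conjI)
qed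

text \<open>The number Hw \<bullet> w is the change of a quadratic function along a quadric, from a critical
  point to the point displaced from it by w, once the multiplier of the critical point has been
  subtracted. If B^T u has a component in the kernel of H, testing with it gives |\<mu>|
  \<lesssim> R, and then w \<bullet> Hw is of order R^2. Otherwise B^T u is in the range of H and
  the scalar relations apply.\<close>

lemma Lojasiewicz_quadric_critical:
  fixes H :: "'a::euclidean_space \<Rightarrow> 'a" and B :: "'a \<Rightarrow> 'b::euclidean_space" and u :: 'b
  assumes linH: "linear H" and sa: "\<And>x y. H x \<bullet> y = x \<bullet> H y" and linB: "linear B"
    and regular: "u \<bullet> B e \<noteq> 0"
  shows "\<exists>C>0. \<exists>\<eta>>0. \<forall>w \<mu> R. norm w \<le> \<eta> \<and> (norm (B w))\<^sup>2 + 2 * (u \<bullet> B w) = 0 \<and>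
      (\<forall>d. \<bar>H w \<bullet> d - \<mu> * ((u + B w) \<bullet> B d)\<bar> \<le> R * norm d) \<longrightarrow> \<bar>H w \<bullet> w\<bar> ^ 3 \<le> C * R ^ 4"
proof -
  obtain kH where kH: "kH > 0" "\<And>x. norm (H x) \<le> kH * norm x" using linear_bounded_pos[OF linH] by auto
  obtain kB where kB: "kB > 0" "\<And>x. norm (B x) \<le> kB * norm x" using linear_bounded_pos[OF linB] by auto
  obtain CH where CH: "CH > 0" "\<And>w. \<exists>n. H n = 0 \<and> norm (w - n) \<le> CH * norm (H w)"
    using kernel_error_bound[OF linH subspace_UNIV] by auto
  \<comment> \<open>The multiplier equation up to an error R, on the quadric through the origin.\<close>
  define admissible where "admissible w \<mu> R \<longleftrightarrow> (norm (B w))\<^sup>2 + 2 * (u \<bullet> B w) = 0 \<and>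
      (\<forall>d. \<bar>H w \<bullet> d - \<mu> * ((u + B w) \<bullet> B d)\<bar> \<le> R * norm d)" for w \<mu> R
  have e0: "e \<noteq> 0" using regular linB by (auto simp: linear_0)
  have R0: "0 \<le> R" if "admissible w \<mu> R" for w \<mu> R
  proof -
    have "0 \<le> R * norm e" using that abs_ge_zero order_trans unfolding admissible_def by blast
    then show ?thesis using e0 by (simp add: zero_le_mult_iff)
  qed
  \<comment> \<open>Near the origin the constraint gradient stays nonzero in direction d, so \<mu> can be recovered from the equation.\<close>
  have multiplier: "\<exists>r>0. \<forall>w \<mu> R. admissible w \<mu> R \<and> norm w \<le> r \<longrightarrow> \<bar>\<mu>\<bar> \<le> 2 * (\<bar>H w \<bullet> d\<bar> + R * norm d)"
    if d: "u \<bullet> B d = 1" for d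
  proof -
    have d0: "d \<noteq> 0" using d linB by (auto simp: linear_0)
    define r where "r = 1 / (2 * (kB * (kB * norm d)))"
    have "\<bar>\<mu>\<bar> \<le> 2 * (\<bar>H w \<bullet> d\<bar> + R * norm d)" if "admissible w \<mu> R" "norm w \<le> r" for w \<mu> R
    proof -
      have "\<bar>B w \<bullet> B d\<bar> \<le> norm (B w) * norm (B d)" by (rule Cauchy_Schwarz_ineq2)
      also have "\<dots> \<le> (kB * r) * (kB * norm d)"
      proof (intro mult_mono)
        show "norm (B w) \<le> kB * r" using kB(2)[of w] that(2) kB(1) mult_left_mono[of "norm w" r kB] by linarith
      qed (use kB d0 in \<open>auto simp: r_def\<close>)
      also have "\<dots> = 1 / 2" using kB d0 by (simp add: r_def)
      finally have "1 / 2 \<le> \<bar>(u + B w) \<bullet> B d\<bar>" using d by (simp add: inner_add_left)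
      then have "\<bar>\<mu>\<bar> * (1 / 2) \<le> \<bar>\<mu> * ((u + B w) \<bullet> B d)\<bar>"
        unfolding abs_mult by (intro mult_left_mono) auto
      also have "\<dots> \<le> \<bar>H w \<bullet> d\<bar> + R * norm d"
      proof -
        have "\<bar>H w \<bullet> d - \<mu> * ((u + B w) \<bullet> B d)\<bar> \<le> R * norm d"
          using that(1) unfolding admissible_def by blast
        then show ?thesis by linarith
      qed
      finally show ?thesis by simp
    qed
    moreover have "r > 0" using kB d0 by (simp add: r_def)
    ultimately show ?thesis by blast
  qed
  have near: "\<exists>C>0. \<exists>\<eta>>0. \<forall>w \<mu> R. admissible w \<mu> R \<and> norm w \<le> \<eta> \<and> R \<le> \<eta> \<longrightarrow> \<bar>H w \<bullet> w\<bar> ^ 3 \<le> C * R ^ 4"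
  proof (cases "\<exists>n. H n = 0 \<and> u \<bullet> B n \<noteq> 0")
    case True
    then obtain n' where n': "H n' = 0" "u \<bullet> B n' \<noteq> 0" by blast
    define n where "n = (1 / (u \<bullet> B n')) *\<^sub>R n'"
    have n: "H n = 0" "u \<bullet> B n = 1" using n' linH linB by (simp_all add: n_def linear_scale)
    obtain r where r: "r > 0" "\<And>w \<mu> R. admissible w \<mu> R \<Longrightarrow> norm w \<le> r \<Longrightarrow> \<bar>\<mu>\<bar> \<le> 2 * (\<bar>H w \<bullet> n\<bar> + R * norm n)"
      using multiplier[OF n(2)] by blast
    define K where "K = 2 * norm n * ((norm u + kB) * kB) + 1"
    have K0: "0 < K" using kB by (auto simp: K_def intro!: add_nonneg_pos)
    have "\<bar>H w \<bullet> w\<bar> ^ 3 \<le> ((CH * K\<^sup>2) ^ 3 * 4) * R ^ 4"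
      if adm: "admissible w \<mu> R" and w: "norm w \<le> min 1 r" and R: "R \<le> min 1 r" for w \<mu> R
    proof -
      have Rn: "0 \<le> R" using R0 adm by blast
      have "H w \<bullet> n = 0" using sa[of w n] n(1) by simp
      then have mu: "\<bar>\<mu>\<bar> \<le> 2 * (R * norm n)" using r(2)[OF adm] w by simp
      have HwK: "norm (H w) \<le> K * R"
      proof (cases "H w = 0")
        case True then show ?thesis using K0 Rn by simp
      next
        case False
        have "norm (u + B w) \<le> norm u + kB"
        proof -
          have "kB * norm w \<le> kB * 1" using w kB(1) by (intro mult_left_mono) auto
          then show ?thesis using norm_triangle_ineq[of u "B w"] kB(2)[of w] by linarith
        qed
        then have "norm (u + B w) * norm (B (H w)) \<le> (norm u + kB) * (kB * norm (H w))"
          using kB by (intro mult_mono) auto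
        then have "\<bar>(u + B w) \<bullet> B (H w)\<bar> \<le> (norm u + kB) * (kB * norm (H w))"
          using Cauchy_Schwarz_ineq2[of "u + B w" "B (H w)"] by linarith
        then have "\<bar>\<mu> * ((u + B w) \<bullet> B (H w))\<bar> \<le> 2 * (R * norm n) * ((norm u + kB) * (kB * norm (H w)))"
          unfolding abs_mult using mu by (intro mult_mono) auto
        moreover have "\<bar>H w \<bullet> H w - \<mu> * ((u + B w) \<bullet> B (H w))\<bar> \<le> R * norm (H w)"
          using adm unfolding admissible_def by blast
        ultimately have "H w \<bullet> H w \<le> R * norm (H w) + 2 * (R * norm n) * ((norm u + kB) * (kB * norm (H w)))"
          by linarith
        then have "norm (H w) * norm (H w) \<le> (K * R) * norm (H w)"
          by (simp add: dot_square_norm power2_eq_square K_def algebra_simps)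
        then show ?thesis using False by simp
      qed
      obtain n0 where n0: "H n0 = 0" "norm (w - n0) \<le> CH * norm (H w)" using CH(2) by blast
      have "H w \<bullet> n0 = 0" using sa[of w n0] n0(1) by simp
      then have "\<bar>H w \<bullet> w\<bar> = \<bar>H w \<bullet> (w - n0)\<bar>" by (simp add: inner_diff_right)
      also have "\<dots> \<le> norm (H w) * norm (w - n0)" by (rule Cauchy_Schwarz_ineq2)
      also have "\<dots> \<le> (K * R) * (CH * (K * R))"
      proof (intro mult_mono HwK)
        show "norm (w - n0) \<le> CH * (K * R)"
          using n0(2) mult_left_mono[OF HwK, of CH] CH(1) by linarith
      qed (use K0 Rn in auto)
      also have "\<dots> = CH * K\<^sup>2 * R * (R + 0)" by (simp add: power2_eq_square mult_ac)
      finally show ?thesis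
        using cube_le_fourth_power_of_small[of "\<bar>H w \<bullet> w\<bar>" "CH * K\<^sup>2" R 0 0] Rn R CH(1) by simp
    qed
    moreover have "0 < (CH * K\<^sup>2) ^ 3 * 4" using CH K0 by simp
    moreover have "0 < min 1 r" using r by simp
    ultimately show ?thesis by blast
  next
    case False
    define g where "g = adjoint B u"
    have g: "g \<bullet> d = u \<bullet> B d" for d
      using adjoint_works[OF linB, of d u] by (simp add: g_def inner_commute)
    have "\<And>n. H n = 0 \<Longrightarrow> g \<bullet> n = 0" using False g by auto
    then obtain a where a: "H a = g" "\<And>n. H n = 0 \<Longrightarrow> B a \<bullet> B n = 0"
      using adapted_preimage[OF linH sa linB] by blast
    have "subspace {n. H n = 0}" using linH by (simp add: linear_subspace_kernel)
    from kernel_error_bound[OF linB this]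
    obtain CB where CB: "CB > 0" "\<And>n. H n = 0 \<Longrightarrow> \<exists>n0. H n0 = 0 \<and> B n0 = 0 \<and> norm (n - n0) \<le> CB * norm (B n)"
      by auto
    define K where "K = 1 + kB + CH + CB + norm a"
    have Kge: "1 \<le> K" "kB \<le> K" "CH \<le> K" "CB \<le> K" "norm a \<le> K" "0 < K"
      using kB(1) CH(1) CB(1) norm_ge_zero[of a] unfolding K_def by linarith+
    have K_CH: "\<exists>n. H n = 0 \<and> norm (w - n) \<le> K * norm (H w)" for w
      using CH(2)[of w] mult_right_mono[OF Kge(3) norm_ge_zero[of "H w"]] order_trans by blast
    have K_CB: "\<exists>n0. H n0 = 0 \<and> B n0 = 0 \<and> norm (n - n0) \<le> K * norm (B n)" if "H n = 0" for n
      using CB(2)[OF that] mult_right_mono[OF Kge(4) norm_ge_zero[of "B n"]] order_trans by blast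
    have K_B: "norm (B x) \<le> K * norm x" for x
      using kB(2)[of x] mult_right_mono[OF Kge(2) norm_ge_zero[of x]] by linarith
    define L where "L = 2 * K ^ 3"
    have K3: "1 \<le> K ^ 3" using Kge(1) by (rule one_le_power)
    then have L1: "1 \<le> L" by (simp add: L_def)
    define d where "d = (1 / (u \<bullet> B e)) *\<^sub>R e"
    have d: "u \<bullet> B d = 1" using regular linB by (simp add: d_def linear_scale)
    have d0: "d \<noteq> 0" using d linB by (auto simp: linear_0)
    obtain r where r: "r > 0" "\<And>w \<mu> R. admissible w \<mu> R \<Longrightarrow> norm w \<le> r \<Longrightarrow> \<bar>\<mu>\<bar> \<le> 2 * (\<bar>H w \<bullet> d\<bar> + R * norm d)"
      using multiplier[OF d] by blast
    obtain C \<eta>s where C: "C > 0" and \<eta>s: "\<eta>s > 0" and scalar: "\<forall>\<mu> p t R F.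
       \<bar>\<mu>\<bar> \<le> \<eta>s \<and> 0 \<le> p \<and> p \<le> \<eta>s \<and> 0 \<le> t \<and> 0 \<le> R \<and> R \<le> \<eta>s \<and>
       \<bar>\<mu>\<bar> * t \<le> L * (R + \<bar>\<mu>\<bar>\<^sup>2 * p) \<and>
       p \<le> L * (t + R + \<bar>\<mu>\<bar> * norm (B a)) \<and>
       \<bar>p\<^sup>2 / 2 + \<mu> * (u \<bullet> B a) + \<mu>\<^sup>2 * (norm (B a))\<^sup>2\<bar> \<le> L * (R + norm (B a) * \<bar>\<mu>\<bar> * (\<bar>\<mu>\<bar> * p + R)) \<and>
       0 \<le> F \<and> F \<le> L * (\<bar>\<mu>\<bar> * p + R)\<^sup>2 + \<bar>\<mu>\<bar> * p\<^sup>2 + \<bar>\<mu>\<bar>\<^sup>2 * \<bar>u \<bullet> B a\<bar>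
       \<longrightarrow> F ^ 3 \<le> C * R ^ 4"
      using scalar_balance[OF L1 norm_ge_zero[of "B a"], of "u \<bullet> B a"] by blast
    define \<eta>m where "\<eta>m = min \<eta>s (1 / L)"
    define \<eta> where "\<eta> = min (min r \<eta>s) (min (\<eta>s / K) (\<eta>m / (2 * (kH + 1) * norm d)))"
    have "0 < \<eta>m" using \<eta>s L1 by (simp add: \<eta>m_def)
    then have \<eta>: "\<eta> > 0" using r \<eta>s Kge kH d0 by (simp add: \<eta>_def)
    have "\<bar>H w \<bullet> w\<bar> ^ 3 \<le> C * R ^ 4"
      if adm: "admissible w \<mu> R" and w: "norm w \<le> \<eta>" and R: "R \<le> \<eta>" for w \<mu> R
    proof -
      have Rn: "0 \<le> R" using R0 adm by blast
      have "\<bar>\<mu>\<bar> \<le> 2 * (\<bar>H w \<bullet> d\<bar> + R * norm d)" using r(2)[OF adm] w by (simp add: \<eta>_def)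
      also have "\<dots> \<le> 2 * (kH * \<eta> * norm d + \<eta> * norm d)"
      proof (intro mult_left_mono add_mono mult_right_mono R)
        have "norm (H w) \<le> kH * \<eta>"
          using kH(2)[of w] mult_left_mono[OF w, of kH] kH(1) by linarith
        then show "\<bar>H w \<bullet> d\<bar> \<le> kH * \<eta> * norm d"
          using Cauchy_Schwarz_ineq2[of "H w" d] mult_right_mono[of "norm (H w)" "kH * \<eta>" "norm d"]
          by simp
      qed auto
      also have "\<dots> = \<eta> * (2 * (kH + 1) * norm d)" by (simp add: algebra_simps)
      also have "\<dots> \<le> \<eta>m / (2 * (kH + 1) * norm d) * (2 * (kH + 1) * norm d)"
        using kH(1) by (intro mult_right_mono) (auto simp: \<eta>_def)
      also have "\<dots> = \<eta>m" using kH(1) d0 by simp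
      finally have mu: "\<bar>\<mu>\<bar> \<le> \<eta>m" .
      have p: "norm (B w) \<le> \<eta>s"
      proof -
        have "norm w \<le> \<eta>s / K" using w by (simp add: \<eta>_def)
        then have "K * norm w \<le> \<eta>s" using Kge(6) by (simp add: field_simps)
        then show ?thesis using K_B[of w] by linarith
      qed
      have small: "2 * K ^ 3 * \<bar>\<mu>\<bar> \<le> 1"
      proof -
        have "\<bar>\<mu>\<bar> \<le> 1 / L" using mu by (simp add: \<eta>m_def)
        then show ?thesis using L1 by (simp add: L_def[symmetric] field_simps)
      qed
      have Ha: "\<And>d. H a \<bullet> d = u \<bullet> B d" using a(1) g by simp
      have q: "(norm (B w))\<^sup>2 + 2 * (u \<bullet> B w) = 0"
        and res: "\<And>d. \<bar>H w \<bullet> d - \<mu> * ((u + B w) \<bullet> B d)\<bar> \<le> R * norm d"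
        using adm unfolding admissible_def by blast+
      obtain t where t: "0 \<le> t" "\<bar>\<mu>\<bar> * t \<le> L * (R + \<bar>\<mu>\<bar>\<^sup>2 * norm (B w))"
         "norm (B w) \<le> L * (t + R + \<bar>\<mu>\<bar> * norm (B a))"
         "\<bar>(norm (B w))\<^sup>2 / 2 + \<mu> * (u \<bullet> B a) + \<mu>\<^sup>2 * (norm (B a))\<^sup>2\<bar>
           \<le> L * (R + norm (B a) * \<bar>\<mu>\<bar> * (\<bar>\<mu>\<bar> * norm (B w) + R))"
         "\<bar>H w \<bullet> w\<bar> \<le> L * (\<bar>\<mu>\<bar> * norm (B w) + R)\<^sup>2 + \<bar>\<mu>\<bar> * (norm (B w))\<^sup>2 + \<bar>\<mu>\<bar>\<^sup>2 * \<bar>u \<bullet> B a\<bar>"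
        using quadric_critical_reduction[OF linH sa linB Kge(1) K_B K_CH K_CB Ha a(2) Kge(5) q res Rn small]
        unfolding L_def by blast
      have "\<bar>\<mu>\<bar> \<le> \<eta>s" "R \<le> \<eta>s" using mu R by (auto simp: \<eta>m_def \<eta>_def)
      then show ?thesis using t p Rn by (intro scalar[rule_format, of \<mu> "norm (B w)" t R]) auto
    qed
    then show ?thesis using C \<eta> by blast
  qed
  then obtain C \<eta> where C: "C > 0" and \<eta>: "\<eta> > 0"
    and near: "\<And>w \<mu> R. admissible w \<mu> R \<Longrightarrow> norm w \<le> \<eta> \<Longrightarrow> R \<le> \<eta> \<Longrightarrow> \<bar>H w \<bullet> w\<bar> ^ 3 \<le> C * R ^ 4"
    by blast
  have "\<bar>H w \<bullet> w\<bar> ^ 3 \<le> (C + kH ^ 3 / \<eta> ^ 4) * R ^ 4"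
    if w: "norm w \<le> min 1 \<eta>" and adm: "admissible w \<mu> R" for w \<mu> R
  proof -
    have "0 \<le> C * R ^ 4" "0 \<le> kH ^ 3 / \<eta> ^ 4 * R ^ 4" using C kH \<eta> R0[OF adm] by auto
    moreover have "\<bar>H w \<bullet> w\<bar> ^ 3 \<le> kH ^ 3 / \<eta> ^ 4 * R ^ 4" if "\<eta> \<le> R"
    proof (rule cube_le_fourth_power_of_large[OF abs_ge_zero _ \<eta> that])
      have "kH * norm w \<le> kH * 1" using w kH(1) by (intro mult_left_mono) auto
      then have "norm (H w) \<le> kH" using kH(2)[of w] by linarith
      then have "norm (H w) * norm w \<le> kH * 1" using w kH(1) by (intro mult_mono) auto
      then show "\<bar>H w \<bullet> w\<bar> \<le> kH" using Cauchy_Schwarz_ineq2[of "H w" w] by linarith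
    qed
    moreover have "\<bar>H w \<bullet> w\<bar> ^ 3 \<le> C * R ^ 4" if "R \<le> \<eta>" using near[OF adm _ that] w by simp
    ultimately show ?thesis by (cases "R \<le> \<eta>") (auto simp: distrib_right)
  qed
  moreover have "C + kH ^ 3 / \<eta> ^ 4 > 0" using C kH \<eta> by (intro add_pos_nonneg) auto
  moreover have "min 1 \<eta> > 0" using \<eta> by simp
  ultimately show ?thesis unfolding admissible_def by blast
qed

text \<open>If \<open>xs\<close> is critical for x \<mapsto> Qx \<bullet> x on the quadric, with multiplier
  \<nu>_0, then along the quadric the function differs from its value at \<open>xs\<close> by Hw
  \<bullet> w, where H = Q - \<nu>_0 B^TB and w is the displacement. If \<open>xs\<close> is not
  critical, the residual is bounded away from zero near \<open>xs\<close>.\<close>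

lemma Lojasiewicz_quadric:
  fixes Q :: "'a::euclidean_space \<Rightarrow> 'a" and B :: "'a \<Rightarrow> 'b::euclidean_space" and b :: 'b
  assumes linQ: "linear Q" and sa: "\<And>x y. Q x \<bullet> y = x \<bullet> Q y" and linB: "linear B"
    and regular: "(B xs - b) \<bullet> B e \<noteq> 0"
  shows "\<exists>C>0. \<exists>\<eta>>0. \<forall>x \<nu> R. norm (x - xs) \<le> \<eta> \<and> norm (B x - b) = norm (B xs - b) \<and>
      (\<forall>d. \<bar>Q x \<bullet> d - \<nu> * ((B x - b) \<bullet> B d)\<bar> \<le> R * norm d)
      \<longrightarrow> \<bar>Q x \<bullet> x - Q xs \<bullet> xs\<bar> ^ 3 \<le> C * R ^ 4"
proof -
  define u where "u = B xs - b"
  define Bt where "Bt = adjoint B"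
  have Bt: "Bt y \<bullet> d = y \<bullet> B d" for y d
    using adjoint_works[OF linB, of d y] by (simp add: Bt_def inner_commute)
  have linBt: "linear Bt" unfolding Bt_def by (rule adjoint_linear[OF linB])
  have Bx: "B x - b = u + B (x - xs)" for x using linB by (simp add: u_def linear_diff)
  show ?thesis
  proof (cases "\<exists>\<nu>0. \<forall>d. Q xs \<bullet> d = \<nu>0 * (u \<bullet> B d)")
    case True
    then obtain \<nu>0 where \<nu>0: "\<And>d. Q xs \<bullet> d = \<nu>0 * (u \<bullet> B d)" by blast
    define H where "H d = Q d - \<nu>0 *\<^sub>R Bt (B d)" for d
    have linH: "linear H"
      unfolding H_def using linQ linB linBt
      by (intro linearI) (simp_all add: linear_add linear_scale algebra_simps)
    have saH: "H x \<bullet> y = x \<bullet> H y" for x y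
      using Bt[of "B x" y] Bt[of "B y" x] sa[of x y]
      by (simp add: H_def inner_diff_left inner_diff_right inner_commute)
    obtain C \<eta> where C: "C > 0" "\<eta> > 0" and *: "\<And>w \<mu> R. norm w \<le> \<eta> \<and> (norm (B w))\<^sup>2 + 2 * (u \<bullet> B w) = 0 \<and>
      (\<forall>d. \<bar>H w \<bullet> d - \<mu> * ((u + B w) \<bullet> B d)\<bar> \<le> R * norm d) \<Longrightarrow> \<bar>H w \<bullet> w\<bar> ^ 3 \<le> C * R ^ 4"
      using Lojasiewicz_quadric_critical[OF linH saH linB, of u e] regular unfolding u_def by blast
    have "\<bar>Q x \<bullet> x - Q xs \<bullet> xs\<bar> ^ 3 \<le> C * R ^ 4"
      if x: "norm (x - xs) \<le> \<eta>" and h: "norm (B x - b) = norm (B xs - b)"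
        and res: "\<And>d. \<bar>Q x \<bullet> d - \<nu> * ((B x - b) \<bullet> B d)\<bar> \<le> R * norm d" for x \<nu> R
    proof -
      define w where "w = x - xs"
      have xw: "x = xs + w" by (simp add: w_def)
      have Bxw: "B x - b = u + B w" using Bx by (simp add: w_def)
      have "(norm (u + B w))\<^sup>2 = (norm u)\<^sup>2" using h Bxw by (simp add: u_def)
      then have quad: "(norm (B w))\<^sup>2 + 2 * (u \<bullet> B w) = 0"
        by (simp add: power2_norm_eq_inner inner_add_left inner_add_right inner_commute)
      have Qx: "Q x = Q xs + Q w" using linQ by (simp add: xw linear_add)
      have Hd: "H w \<bullet> d = Q w \<bullet> d - \<nu>0 * (B w \<bullet> B d)" for d by (simp add: H_def inner_diff_left Bt)
      have "\<bar>H w \<bullet> d - (\<nu> - \<nu>0) * ((u + B w) \<bullet> B d)\<bar> \<le> R * norm d" for d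
      proof -
        have "H w \<bullet> d - (\<nu> - \<nu>0) * ((u + B w) \<bullet> B d) = Q x \<bullet> d - \<nu> * ((B x - b) \<bullet> B d)"
          unfolding Hd Qx Bxw by (simp add: inner_add_left \<nu>0 algebra_simps)
        then show ?thesis using res[of d] by simp
      qed
      moreover have "Q x \<bullet> x - Q xs \<bullet> xs = H w \<bullet> w"
      proof -
        have "Q x \<bullet> x - Q xs \<bullet> xs = Q w \<bullet> w + 2 * (Q xs \<bullet> w)"
          using sa[of w xs] by (simp add: Qx) (simp add: xw inner_add_left inner_add_right inner_commute)
        also have "\<dots> = Q w \<bullet> w + \<nu>0 * (2 * (u \<bullet> B w))" by (simp add: \<nu>0)
        also have "2 * (u \<bullet> B w) = - (B w \<bullet> B w)" using quad by (simp add: power2_norm_eq_inner)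
        finally show ?thesis by (simp add: Hd)
      qed
      ultimately show ?thesis using *[of w "\<nu> - \<nu>0" R] x quad unfolding w_def[symmetric] by metis
    qed
    then show ?thesis using C by blast
  next
    case False
    obtain kQ where kQ: "kQ > 0" "\<And>x. norm (Q x) \<le> kQ * norm x" using linear_bounded_pos[OF linQ] by auto
    obtain kB where kB: "kB > 0" "\<And>x. norm (B x) \<le> kB * norm x" using linear_bounded_pos[OF linB] by auto
    define g where "g = Bt u"
    have g: "g \<bullet> d = u \<bullet> B d" for d by (simp add: g_def Bt)
    \<comment> \<open>The tangential gradient at the base point; it is nonzero, and testing with it bounds the residual below.\<close>
    define d0 where "d0 = Q xs - (Q xs \<bullet> g / (g \<bullet> g)) *\<^sub>R g"
    have "d0 \<noteq> 0"
    proof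
      assume "d0 = 0"
      then have "Q xs = (Q xs \<bullet> g / (g \<bullet> g)) *\<^sub>R g" by (simp add: d0_def)
      then have "Q xs \<bullet> d = (Q xs \<bullet> g / (g \<bullet> g)) * (u \<bullet> B d)" for d
        using g[of d] by (metis inner_scaleR_left)
      then show False using False by blast
    qed
    have "g \<noteq> 0" using g[of e] regular by (auto simp: u_def)
    then have gd0: "g \<bullet> d0 = 0" by (simp add: d0_def inner_diff_right inner_commute)
    then have qd0: "Q xs \<bullet> d0 = d0 \<bullet> d0"
      by (simp add: d0_def inner_diff_left inner_diff_right inner_commute)
    define d where "d = (1 / (u \<bullet> B e)) *\<^sub>R e"
    have d: "u \<bullet> B d = 1" using regular linB by (simp add: d_def linear_scale u_def)
    have dn: "d \<noteq> 0" using d linB by (auto simp: linear_0)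
    define M where "M = 2 * ((kQ * (norm xs + 1) + 1) * norm d)"
    define T where "T = kQ + M * (kB * kB)"
    have M0: "0 < M" using kQ dn by (auto simp: M_def intro!: mult_pos_pos add_nonneg_pos)
    have T0: "0 < T" using kQ kB M0 by (auto simp: T_def intro!: add_pos_pos)
    define \<eta> where "\<eta> = min 1 (min (1 / (2 * (kB * (kB * norm d)))) (norm d0 / (2 * T)))"
    have \<eta>: "\<eta> > 0" using kB dn T0 \<open>d0 \<noteq> 0\<close> by (simp add: \<eta>_def)
    define r where "r = min 1 (norm d0 / 2)"
    have r: "r > 0" using \<open>d0 \<noteq> 0\<close> by (simp add: r_def)
    define F where "F = kQ * (norm xs + 1) * (norm xs + 1) + \<bar>Q xs \<bullet> xs\<bar> + 1"
    have "0 \<le> kQ * (norm xs + 1) * (norm xs + 1)" using kQ by simp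
    then have F: "F > 0" unfolding F_def by linarith
    have "\<bar>Q x \<bullet> x - Q xs \<bullet> xs\<bar> ^ 3 \<le> (F ^ 3 / r ^ 4) * R ^ 4"
      if x: "norm (x - xs) \<le> \<eta>"
        and res: "\<And>d. \<bar>Q x \<bullet> d - \<nu> * ((B x - b) \<bullet> B d)\<bar> \<le> R * norm d" for x \<nu> R
    proof -
      define w where "w = x - xs"
      have xw: "x = xs + w" by (simp add: w_def)
      have Bxw: "B x - b = u + B w" using Bx by (simp add: w_def)
      have Qx: "Q x = Q xs + Q w" using linQ by (simp add: xw linear_add)
      have w: "norm w \<le> 1" "norm w \<le> 1 / (2 * (kB * (kB * norm d)))" "norm w \<le> norm d0 / (2 * T)"
        using x by (auto simp: \<eta>_def w_def)
      have "norm x \<le> norm xs + 1" using w(1) norm_triangle_ineq[of xs w] by (simp add: xw)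
      then have nQx: "norm (Q x) \<le> kQ * (norm xs + 1)" and nx: "norm x \<le> norm xs + 1"
        using kQ(2)[of x] mult_left_mono[of "norm x" "norm xs + 1" kQ] kQ(1) by linarith+
      have BwB: "\<bar>B w \<bullet> B z\<bar> \<le> kB * kB * norm w * norm z" for z
      proof -
        have "\<bar>B w \<bullet> B z\<bar> \<le> norm (B w) * norm (B z)" by (rule Cauchy_Schwarz_ineq2)
        also have "\<dots> \<le> (kB * norm w) * (kB * norm z)" using kB by (intro mult_mono) auto
        finally show ?thesis by (simp add: mult_ac)
      qed
      \<comment> \<open>For a small residual the multiplier is at most M, and testing with d_0 would make d_0 too short.\<close>
      have "r \<le> R"
      proof (rule ccontr)
        assume "\<not> r \<le> R"
        then have R: "R < 1" "R < norm d0 / 2" by (auto simp: r_def)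
        have "\<bar>B w \<bullet> B d\<bar> \<le> 1 / 2"
        proof -
          have "norm w * (2 * (kB * (kB * norm d))) \<le> 1"
            using w(2) kB dn by (simp add: pos_le_divide_eq)
          then show ?thesis using BwB[of d] by (simp add: mult_ac)
        qed
        then have "1 / 2 \<le> \<bar>(u + B w) \<bullet> B d\<bar>" using d by (simp add: inner_add_left)
        then have "\<bar>\<nu>\<bar> * (1 / 2) \<le> \<bar>\<nu> * ((u + B w) \<bullet> B d)\<bar>"
          unfolding abs_mult by (intro mult_left_mono) auto
        also have "\<dots> \<le> \<bar>Q x \<bullet> d\<bar> + R * norm d" using res[of d] unfolding Bxw by linarith
        also have "\<dots> \<le> kQ * (norm xs + 1) * norm d + 1 * norm d"
          using Cauchy_Schwarz_ineq2[of "Q x" d] mult_right_mono[OF nQx norm_ge_zero[of d]]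
            mult_right_mono[OF less_imp_le[OF R(1)] norm_ge_zero[of d]] by linarith
        finally have \<nu>: "\<bar>\<nu>\<bar> \<le> M" by (simp add: M_def algebra_simps)
        have "\<bar>\<nu> * (B w \<bullet> B d0)\<bar> \<le> M * (kB * kB * norm w * norm d0)"
          unfolding abs_mult using \<nu> BwB[of d0] M0 by (intro mult_mono) auto
        moreover have "\<bar>Q w \<bullet> d0\<bar> \<le> kQ * norm w * norm d0"
          using Cauchy_Schwarz_ineq2[of "Q w" d0] mult_right_mono[OF kQ(2)[of w] norm_ge_zero[of d0]] by linarith
        moreover have "\<bar>d0 \<bullet> d0 + Q w \<bullet> d0 - \<nu> * (B w \<bullet> B d0)\<bar> \<le> R * norm d0"
          using res[of d0] gd0 unfolding Bxw Qx by (simp add: inner_add_left g qd0)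
        ultimately have "d0 \<bullet> d0 \<le> R * norm d0 + kQ * norm w * norm d0 + M * (kB * kB * norm w * norm d0)"
          by linarith
        then have "norm d0 * norm d0 \<le> (R + T * norm w) * norm d0"
          by (simp add: dot_square_norm power2_eq_square T_def algebra_simps)
        then have "norm d0 \<le> R + T * norm w" using \<open>d0 \<noteq> 0\<close> by simp
        moreover have "T * norm w \<le> norm d0 / 2"
          using w(3) T0 by (simp add: pos_le_divide_eq mult_ac)
        ultimately show False using R(2) by linarith
      qed
      moreover have "\<bar>Q x \<bullet> x - Q xs \<bullet> xs\<bar> \<le> F"
      proof -
        have "\<bar>Q x \<bullet> x\<bar> \<le> norm (Q x) * norm x" by (rule Cauchy_Schwarz_ineq2)
        also have "\<dots> \<le> kQ * (norm xs + 1) * (norm xs + 1)" using nQx nx kQ by (intro mult_mono) auto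
        finally show ?thesis unfolding F_def by linarith
      qed
      ultimately show ?thesis using cube_le_fourth_power_of_large[OF abs_ge_zero _ r] by blast
    qed
    moreover have "F ^ 3 / r ^ 4 > 0" using F r by simp
    ultimately show ?thesis using \<eta> by blast
  qed
qed

text \<open>For e = 0 the kernel component of w does not contribute to w \<bullet> Hw, and the rest of w is
  of order |Hw|. For e \<noteq> 0 the gradient does not vanish near the origin.\<close>

lemma Lojasiewicz_quadratic:
  fixes H :: "'a::euclidean_space \<Rightarrow> 'a"
  assumes linH: "linear H" and sa: "\<And>x y. H x \<bullet> y = x \<bullet> H y"
  shows "\<exists>C>0. \<exists>\<eta>>0. \<forall>w. norm w \<le> \<eta> \<longrightarrow> \<bar>H w \<bullet> w + 2 * (e \<bullet> w)\<bar> ^ 3 \<le> C * norm (H w + e) ^ 4"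
proof -
  obtain kH where kH: "kH > 0" "\<And>x. norm (H x) \<le> kH * norm x" using linear_bounded_pos[OF linH] by auto
  have nHw: "norm (H w) \<le> kH" if "norm w \<le> 1" for w
    using kH(2)[of w] mult_left_mono[OF that, of kH] kH(1) by linarith
  show ?thesis
  proof (cases "e = 0")
    case True
    obtain CH where CH: "CH > 0" "\<And>w. \<exists>n. H n = 0 \<and> norm (w - n) \<le> CH * norm (H w)"
      using kernel_error_bound[OF linH subspace_UNIV] by auto
    have "\<bar>H w \<bullet> w\<bar> ^ 3 \<le> (CH ^ 3 * kH\<^sup>2) * norm (H w) ^ 4" if w: "norm w \<le> 1" for w
    proof -
      obtain n where n: "H n = 0" "norm (w - n) \<le> CH * norm (H w)" using CH(2) by blast
      have "H w \<bullet> n = 0" using sa[of w n] n(1) by simp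
      then have "\<bar>H w \<bullet> w\<bar> = \<bar>H w \<bullet> (w - n)\<bar>" by (simp add: inner_diff_right)
      also have "\<dots> \<le> norm (H w) * norm (w - n)" by (rule Cauchy_Schwarz_ineq2)
      also have "\<dots> \<le> norm (H w) * (CH * norm (H w))" using n(2) by (intro mult_left_mono) auto
      finally have "\<bar>H w \<bullet> w\<bar> ^ 3 \<le> (norm (H w) * (CH * norm (H w))) ^ 3" by (intro power_mono) auto
      also have "\<dots> = CH ^ 3 * norm (H w) ^ 4 * (norm (H w))\<^sup>2"
        by (simp add: power_mult_distrib eval_nat_numeral)
      also have "\<dots> \<le> CH ^ 3 * norm (H w) ^ 4 * kH\<^sup>2"
        using nHw[OF w] CH(1) by (intro mult_left_mono power_mono) auto
      finally show ?thesis by (simp add: mult_ac)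
    qed
    then show ?thesis using CH kH True by (intro exI[of _ "CH ^ 3 * kH\<^sup>2"] conjI exI[of _ 1]) auto
  next
    case False
    define \<eta> where "\<eta> = min 1 (norm e / (2 * kH))"
    define M where "M = kH + 2 * norm e"
    define r where "r = norm e / 2"
    have pos: "\<eta> > 0" "M > 0" "r > 0" using False kH by (auto simp: \<eta>_def M_def r_def intro!: add_pos_pos)
    have "\<bar>H w \<bullet> w + 2 * (e \<bullet> w)\<bar> ^ 3 \<le> (M ^ 3 / r ^ 4) * norm (H w + e) ^ 4" if w: "norm w \<le> \<eta>" for w
    proof (rule cube_le_fourth_power_of_large[OF abs_ge_zero _ pos(3)])
      have w1: "norm w \<le> 1" using w by (simp add: \<eta>_def)
      have "norm (H w) * norm w \<le> kH * 1" using nHw[OF w1] w1 kH by (intro mult_mono) auto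
      moreover have "norm e * norm w \<le> norm e * 1" using w1 by (intro mult_left_mono) auto
      ultimately show "\<bar>H w \<bullet> w + 2 * (e \<bullet> w)\<bar> \<le> M"
        using Cauchy_Schwarz_ineq2[of "H w" w] Cauchy_Schwarz_ineq2[of e w] unfolding M_def by linarith
      have "norm w \<le> norm e / (2 * kH)" using w by (simp add: \<eta>_def)
      then have "kH * norm w \<le> norm e / 2" using kH(1) by (simp add: field_simps)
      then have "norm (H w) \<le> norm e / 2" using kH(2)[of w] by linarith
      moreover have "norm e \<le> norm (H w + e) + norm (H w)"
        using norm_triangle_ineq4[of "H w + e" "H w"] by simp
      ultimately show "r \<le> norm (H w + e)" unfolding r_def by linarith
    qed
    moreover have "M ^ 3 / r ^ 4 > 0" using pos by simp
    ultimately show ?thesis using pos(1) by blast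
  qed
qed

lemma orthogonal_projection_exists:
  fixes V :: "'a::euclidean_space set"
  assumes "subspace V"
  shows "\<exists>P. linear P \<and> (\<forall>x y. P x \<bullet> y = x \<bullet> P y) \<and> (\<forall>x. P x \<in> V) \<and> (\<forall>x\<in>V. P x = x) \<and>
    (\<forall>x. norm (P x) \<le> norm x)"
proof -
  obtain D where D: "D \<subseteq> V" "pairwise orthogonal D" "\<And>x. x \<in> D \<Longrightarrow> norm x = 1"
    "independent D" "span D = V"
    using orthonormal_basis_subspace[OF assms] by metis
  have fin: "finite D" using D(4) by (rule independent_imp_finite)
  define P where "P x = (\<Sum>i\<in>D. (x \<bullet> i) *\<^sub>R i)" for x
  have lin: "linear P"
    unfolding P_def
    by (intro linearI) (simp_all add: inner_add_left scaleR_add_left sum.distrib scaleR_sum_right)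
  have sa: "P x \<bullet> y = x \<bullet> P y" for x y
    by (simp add: P_def inner_sum_left inner_sum_right inner_commute mult.commute)
  have PV: "P x \<in> V" for x
    unfolding P_def using D(1) assms by (intro subspace_sum subspace_scale) auto
  have id: "P x = x" if "x \<in> V" for x
    unfolding P_def using D that fin by (intro orthonormal_basis_expand) auto
  have "norm (P x) \<le> norm x" for x
  proof (cases "P x = 0")
    case False
    have "norm (P x) * norm (P x) = x \<bullet> P x"
      using sa[of x "P x"] id[OF PV[of x]] by (simp add: dot_square_norm power2_eq_square)
    also have "\<dots> \<le> norm x * norm (P x)" by (rule norm_cauchy_schwarz)
    finally show ?thesis using False by simp
  qed simp
  then show ?thesis using lin sa PV id by blast
qed

text \<open>The affine version: the restriction of the quadratic form to the translate of V through
  \<open>xs\<close> has gradient 2P(Qx) with P the orthogonal projection onto V.\<close>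

lemma Lojasiewicz_quadratic_on_affine:
  fixes Q :: "'a::euclidean_space \<Rightarrow> 'a"
  assumes linQ: "linear Q" and sa: "\<And>x y. Q x \<bullet> y = x \<bullet> Q y" and V: "subspace V"
  shows "\<exists>C>0. \<exists>\<eta>>0. \<forall>x R. norm (x - xs) \<le> \<eta> \<and> x - xs \<in> V \<and> 0 \<le> R \<and> (\<forall>d\<in>V. \<bar>Q x \<bullet> d\<bar> \<le> R * norm d)
      \<longrightarrow> \<bar>Q x \<bullet> x - Q xs \<bullet> xs\<bar> ^ 3 \<le> C * R ^ 4"
proof -
  obtain P where P: "linear P" "\<And>x y. P x \<bullet> y = x \<bullet> P y" "\<And>x. P x \<in> V" "\<And>x. x \<in> V \<Longrightarrow> P x = x"
    using orthogonal_projection_exists[OF V] by blast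
  define H where "H x = P (Q (P x))" for x
  have linH: "linear H" unfolding H_def using linear_compose[OF linear_compose[OF P(1) linQ] P(1)]
    by (simp add: o_def)
  have saH: "H x \<bullet> y = x \<bullet> H y" for x y by (simp add: H_def P(2) sa)
  obtain C \<eta> where C: "C > 0" "\<eta> > 0" and
    *: "\<And>w. norm w \<le> \<eta> \<Longrightarrow> \<bar>H w \<bullet> w + 2 * (P (Q xs) \<bullet> w)\<bar> ^ 3 \<le> C * norm (H w + P (Q xs)) ^ 4"
    using Lojasiewicz_quadratic[OF linH saH, of "P (Q xs)"] by blast
  have "\<bar>Q x \<bullet> x - Q xs \<bullet> xs\<bar> ^ 3 \<le> C * R ^ 4"
    if x: "norm (x - xs) \<le> \<eta>" "x - xs \<in> V" and R: "0 \<le> R"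
      and res: "\<And>d. d \<in> V \<Longrightarrow> \<bar>Q x \<bullet> d\<bar> \<le> R * norm d" for x R
  proof -
    define w where "w = x - xs"
    have xw: "x = xs + w" and Pw: "P w = w" using x(2) P(4) by (auto simp: w_def)
    have Qx: "Q x = Q xs + Q w" using linQ by (simp add: xw linear_add)
    have z: "H w + P (Q xs) = P (Q x)" using P(1) by (simp add: H_def Pw Qx linear_add)
    have "norm (P (Q x)) \<le> R"
    proof (cases "P (Q x) = 0")
      case False
      have "P (Q x) \<bullet> P (Q x) = Q x \<bullet> P (Q x)" using P(2)[of "Q x" "P (Q x)"] P(4)[OF P(3)] by simp
      also have "\<dots> \<le> R * norm (P (Q x))" using res[OF P(3)] abs_le_D1 by blast
      finally show ?thesis using False by (simp add: dot_square_norm power2_eq_square)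
    qed (use R in simp)
    then have "C * norm (P (Q x)) ^ 4 \<le> C * R ^ 4" using C by (intro mult_left_mono power_mono) auto
    moreover have "Q x \<bullet> x - Q xs \<bullet> xs = H w \<bullet> w + 2 * (P (Q xs) \<bullet> w)"
      using sa[of w xs] P(2)[of "Q w" w] P(2)[of "Q xs" w]
      by (simp add: H_def Pw Qx) (simp add: xw inner_add_left inner_add_right inner_commute)
    ultimately show ?thesis using *[of w] x(1) unfolding z w_def[symmetric] by simp
  qed
  then show ?thesis using C by blast
qed

text \<open>Replacing Q by PQP and B by BP, with P the orthogonal projection onto V, turns a residual that
  is only tested on V into one tested on the whole space.\<close>

lemma Lojasiewicz_quadric_in_subspace:
  fixes Q :: "'a::euclidean_space \<Rightarrow> 'a" and B :: "'a \<Rightarrow> 'b::euclidean_space" and b :: 'b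
  assumes linQ: "linear Q" and sa: "\<And>x y. Q x \<bullet> y = x \<bullet> Q y" and linB: "linear B"
    and V: "subspace V" and xs: "xs \<in> V" and e: "e \<in> V" "(B xs - b) \<bullet> B e \<noteq> 0"
  shows "\<exists>C>0. \<exists>\<eta>>0. \<forall>x \<nu> R. norm (x - xs) \<le> \<eta> \<and> x \<in> V \<and> norm (B x - b) = norm (B xs - b) \<and> 0 \<le> R \<and>
      (\<forall>d\<in>V. \<bar>Q x \<bullet> d - \<nu> * ((B x - b) \<bullet> B d)\<bar> \<le> R * norm d)
      \<longrightarrow> \<bar>Q x \<bullet> x - Q xs \<bullet> xs\<bar> ^ 3 \<le> C * R ^ 4"
proof -
  obtain P where P: "linear P" "\<And>x y. P x \<bullet> y = x \<bullet> P y" "\<And>x. P x \<in> V" "\<And>x. x \<in> V \<Longrightarrow> P x = x"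
    "\<And>x. norm (P x) \<le> norm x"
    using orthogonal_projection_exists[OF V] by blast
  define H where "H x = P (Q (P x))" for x
  define B' where "B' x = B (P x)" for x
  have linH: "linear H" unfolding H_def using linear_compose[OF linear_compose[OF P(1) linQ] P(1)]
    by (simp add: o_def)
  have linB': "linear B'" unfolding B'_def using linear_compose[OF P(1) linB] by (simp add: o_def)
  have saH: "H x \<bullet> y = x \<bullet> H y" for x y by (simp add: H_def P(2) sa)
  have "(B' xs - b) \<bullet> B' e \<noteq> 0" using e xs by (simp add: B'_def P(4))
  then obtain C \<eta> where C: "C > 0" "\<eta> > 0" and
    *: "\<And>x \<nu> R. norm (x - xs) \<le> \<eta> \<and> norm (B' x - b) = norm (B' xs - b) \<and>
      (\<forall>d. \<bar>H x \<bullet> d - \<nu> * ((B' x - b) \<bullet> B' d)\<bar> \<le> R * norm d)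
      \<Longrightarrow> \<bar>H x \<bullet> x - H xs \<bullet> xs\<bar> ^ 3 \<le> C * R ^ 4"
    using Lojasiewicz_quadric[OF linH saH linB', of xs b e] by blast
  have "\<bar>Q x \<bullet> x - Q xs \<bullet> xs\<bar> ^ 3 \<le> C * R ^ 4"
    if x: "norm (x - xs) \<le> \<eta>" "x \<in> V" "norm (B x - b) = norm (B xs - b)" and R: "0 \<le> R"
      and res: "\<And>d. d \<in> V \<Longrightarrow> \<bar>Q x \<bullet> d - \<nu> * ((B x - b) \<bullet> B d)\<bar> \<le> R * norm d" for x \<nu> R
  proof -
    have "\<bar>H x \<bullet> d - \<nu> * ((B' x - b) \<bullet> B' d)\<bar> \<le> R * norm d" for d
      using res[OF P(3)[of d]] mult_left_mono[OF P(5)[of d] R] P(2)[of "Q x" d]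
      by (simp add: H_def B'_def P(4)[OF x(2)])
    moreover have "H x \<bullet> x = Q x \<bullet> x" "H xs \<bullet> xs = Q xs \<bullet> xs"
      using P(4)[OF x(2)] P(4)[OF xs] P(2)[of "Q x" x] P(2)[of "Q xs" xs] by (auto simp: H_def)
    ultimately show ?thesis using *[of x \<nu> R] x xs by (simp add: B'_def P(4))
  qed
  then show ?thesis using C by blast
qed

section \<open>Convergence of descent sequences\<close>

text \<open>Put \<delta>_k = |x_(k+1)-x_k| and \<rho>_k = v_k^(1/4). For large k and x_(k+1) near x_*, the
  Lojasiewicz inequality gives \<rho>_(k+1)^3 \<lesssim> \<delta>_k, and with the decrease
  condition \<delta>_(k+1)^2 \<lesssim> \<rho>_(k+1)^4 - \<rho>_(k+2)^4 \<lesssim>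
  \<delta>_k(\<rho>_(k+1)-\<rho>_(k+2)). By the inequality of the means, 2\<delta>_(k+1) \<le>
  \<delta>_k + K(\<rho>_(k+1)-\<rho>_(k+2)), which says that |x_(k+1)-x_*| + \<delta>_k +
  K\<rho>_(k+1) does not increase as long as it is at most \<eta>. Since it is arbitrarily small
  along the subsequence, the iterates cannot leave the neighbourhood again.\<close>

lemma convergence_by_Lojasiewicz:
  fixes x :: "nat \<Rightarrow> 'a::real_normed_vector" and v :: "nat \<Rightarrow> real"
  assumes vnn: "\<And>k. 0 \<le> v k" and vlim: "v \<longlonglongrightarrow> 0" and c: "0 < c"
    and dec: "\<And>k. c * (norm (x (Suc k) - x k))\<^sup>2 \<le> v k - v (Suc k)"
    and \<eta>: "0 < \<eta>" and C: "0 < C"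
    and KL: "\<And>k. norm (x (Suc k) - xs) \<le> \<eta> \<Longrightarrow>
      v (Suc k) ^ 3 \<le> C * (norm (x (Suc k) - x k) + v (Suc k)) ^ 4"
    and cluster: "strict_mono r" "(x \<circ> r) \<longlonglongrightarrow> xs"
  shows "x \<longlonglongrightarrow> xs"
proof -
  define \<delta> where "\<delta> k = norm (x (Suc k) - x k)" for k
  define \<rho> where "\<rho> k = root 4 (v k)" for k
  define D where "D = root 4 (16 * C)"
  define K where "K = 4 * D / c"
  define E where "E k = norm (x (Suc k) - xs) + \<delta> k + K * \<rho> (Suc k)" for k
  have \<delta>0: "0 \<le> \<delta> k" for k by (simp add: \<delta>_def)
  have \<rho>0: "0 \<le> \<rho> k" and \<rho>4: "\<rho> k ^ 4 = v k" for k using vnn[of k] by (simp_all add: \<rho>_def)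
  have D0: "0 \<le> D" and D4: "D ^ 4 = 16 * C" using C by (simp_all add: D_def)
  have K0: "0 \<le> K" using D0 c by (simp add: K_def)
  have vdec: "v (Suc k) \<le> v k" for k
  proof -
    have "0 \<le> c * (norm (x (Suc k) - x k))\<^sup>2" using c by simp
    then show ?thesis using dec[of k] by linarith
  qed
  have \<rho>dec: "\<rho> (Suc k) \<le> \<rho> k" for k using vdec[of k] by (simp add: \<rho>_def)
  have \<rho>lim: "\<rho> \<longlonglongrightarrow> 0" using tendsto_real_root[OF vlim, of 4] by (simp add: \<rho>_def[abs_def])
  have \<delta>lim: "\<delta> \<longlonglongrightarrow> 0"
  proof -
    have "(\<lambda>k. sqrt (v k / c)) \<longlonglongrightarrow> sqrt (0 / c)" by (intro tendsto_intros vlim) (use c in simp)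
    then have lim: "(\<lambda>k. sqrt (v k / c)) \<longlonglongrightarrow> 0" by simp
    have "\<delta> k \<le> sqrt (v k / c)" for k
    proof (rule real_le_rsqrt)
      show "(\<delta> k)\<^sup>2 \<le> v k / c"
        using dec[of k] vnn[of "Suc k"] c by (simp add: \<delta>_def field_simps)
    qed
    then show ?thesis using \<delta>0 by (intro tendsto_sandwich[OF _ _ tendsto_const lim]) auto
  qed
  obtain N where N: "\<And>k. k \<ge> N \<Longrightarrow> 16 * C * v k \<le> 1"
  proof -
    have "(\<lambda>k. 16 * C * v k) \<longlonglongrightarrow> 16 * C * 0" by (intro tendsto_intros vlim)
    then have "eventually (\<lambda>k. 16 * C * v k < 1) sequentially" by (rule order_tendstoD) simp
    then obtain N where "\<And>k. k \<ge> N \<Longrightarrow> 16 * C * v k < 1" unfolding eventually_sequentially by blast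
    then show ?thesis using that less_imp_le by blast
  qed
  have desingularized: "\<rho> (Suc k) ^ 3 \<le> D * \<delta> k" if k: "k \<ge> N" and near: "norm (x (Suc k) - xs) \<le> \<eta>" for k
  proof -
    define a where "a = v (Suc k)"
    have a0: "0 \<le> a" by (simp add: a_def vnn)
    have "C * (\<delta> k + a) ^ 4 \<le> C * (8 * (\<delta> k ^ 4 + a ^ 4))"
      using C by (intro mult_left_mono power4_add_le) auto
    then have "a ^ 3 \<le> C * (8 * (\<delta> k ^ 4 + a ^ 4))" using KL[OF near] by (simp add: a_def \<delta>_def)
    also have "\<dots> = 8 * C * \<delta> k ^ 4 + (16 * C * a) * a ^ 3 / 2"
      by (simp add: algebra_simps power4_eq_xxxx power3_eq_cube)
    also have "\<dots> \<le> 8 * C * \<delta> k ^ 4 + 1 * a ^ 3 / 2"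
      using N[of "Suc k"] k a0 C by (intro add_mono divide_right_mono mult_right_mono) (auto simp: a_def)
    finally have "a ^ 3 \<le> 16 * C * \<delta> k ^ 4" by simp
    moreover have "(\<rho> (Suc k) ^ 3) ^ 4 = a ^ 3" unfolding a_def \<rho>4[symmetric] by (simp flip: power_mult)
    moreover have "(D * \<delta> k) ^ 4 = 16 * C * \<delta> k ^ 4" by (simp add: power_mult_distrib D4)
    ultimately have "(\<rho> (Suc k) ^ 3) ^ 4 \<le> (D * \<delta> k) ^ 4" by linarith
    moreover have "0 \<le> \<rho> (Suc k) ^ 3" "0 \<le> D * \<delta> k" using \<rho>0 D0 \<delta>0 by simp_all
    moreover have "(0::nat) < 4" by simp
    ultimately show ?thesis using power_mono_iff[of "\<rho> (Suc k) ^ 3" "D * \<delta> k" 4] by blast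
  qed
  have amgm: "d * z \<le> ((d + z) / 2)\<^sup>2" for d z :: real
    using zero_le_power2[of "d - z"] by (simp add: power_divide power2_eq_square algebra_simps)
  have step: "2 * \<delta> (Suc k) \<le> \<delta> k + K * (\<rho> (Suc k) - \<rho> (Suc (Suc k)))"
    if k: "k \<ge> N" and near: "norm (x (Suc k) - xs) \<le> \<eta>" for k
  proof -
    define s where "s = \<rho> (Suc k)"
    define t where "t = \<rho> (Suc (Suc k))"
    have st: "0 \<le> t" "t \<le> s" using \<rho>0 \<rho>dec by (auto simp: s_def t_def)
    have "s ^ 4 - t ^ 4 = (s - t) * (s ^ 3 + s\<^sup>2 * t + s * t\<^sup>2 + t ^ 3)"
      by (simp add: algebra_simps eval_nat_numeral)
    also have "\<dots> \<le> (s - t) * (s ^ 3 + s\<^sup>2 * s + s * s\<^sup>2 + s ^ 3)"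
      using st by (intro mult_left_mono add_mono power_mono) auto
    also have "\<dots> = 4 * s ^ 3 * (s - t)" by (simp add: algebra_simps eval_nat_numeral)
    also have "\<dots> \<le> 4 * (D * \<delta> k) * (s - t)"
      using desingularized[OF k near] st unfolding s_def[symmetric] by (intro mult_right_mono mult_left_mono) auto
    finally have "s ^ 4 - t ^ 4 \<le> 4 * (D * \<delta> k) * (s - t)" .
    then have "c * (\<delta> (Suc k))\<^sup>2 \<le> 4 * (D * \<delta> k) * (s - t)"
      using dec[of "Suc k"] by (simp add: s_def t_def \<rho>4 \<delta>_def)
    then have "(\<delta> (Suc k))\<^sup>2 \<le> \<delta> k * (K * (s - t))" using c by (simp add: K_def field_simps)
    also have "\<dots> \<le> ((\<delta> k + K * (s - t)) / 2)\<^sup>2" by (rule amgm)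
    finally have "\<delta> (Suc k) \<le> (\<delta> k + K * (s - t)) / 2"
      by (rule power2_le_imp_le) (use \<delta>0[of k] K0 st in simp)
    then show ?thesis by (simp add: s_def t_def)
  qed
  have potential: "E (Suc k) \<le> E k" if k: "k \<ge> N" and near: "E k \<le> \<eta>" for k
  proof -
    have "0 \<le> K * \<rho> (Suc k)" using K0 \<rho>0 by simp
    then have "norm (x (Suc k) - xs) \<le> \<eta>" using near \<delta>0[of k] unfolding E_def by linarith
    from step[OF k this]
    have "2 * \<delta> (Suc k) + K * \<rho> (Suc (Suc k)) \<le> \<delta> k + K * \<rho> (Suc k)" by (simp add: algebra_simps)
    moreover have "norm (x (Suc (Suc k)) - xs) \<le> norm (x (Suc k) - xs) + \<delta> (Suc k)"
      using norm_triangle_ineq[of "x (Suc k) - xs" "x (Suc (Suc k)) - x (Suc k)"]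
      by (simp add: \<delta>_def)
    ultimately show ?thesis unfolding E_def by linarith
  qed
  show ?thesis
  proof (rule LIMSEQ_I)
    fix e :: real assume e: "0 < e"
    define m where "m = min e \<eta> / 3"
    have m0: "0 < m" using e \<eta> by (simp add: m_def)
    have "eventually (\<lambda>k. \<delta> k < m) sequentially" using \<delta>lim m0 by (rule order_tendstoD)
    then obtain M1 where M1: "\<And>k. k \<ge> M1 \<Longrightarrow> \<delta> k < m" unfolding eventually_sequentially by blast
    have "(\<lambda>k. K * \<rho> k) \<longlonglongrightarrow> K * 0" by (intro tendsto_intros \<rho>lim)
    then have "eventually (\<lambda>k. K * \<rho> k < m) sequentially" using m0 by (intro order_tendstoD) auto
    then obtain M2 where M2: "\<And>k. k \<ge> M2 \<Longrightarrow> K * \<rho> k < m" unfolding eventually_sequentially by blast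
    obtain J where J: "\<And>j. j \<ge> J \<Longrightarrow> norm (x (r j) - xs) < m"
      using LIMSEQ_D[OF cluster(2) m0] by auto
    define j where "j = J + M1 + M2 + N + 1"
    define k0 where "k0 = r j - 1"
    have "r j \<ge> j" using cluster(1) by (rule seq_suble)
    then have k0: "Suc k0 = r j" "k0 \<ge> M1" "Suc k0 \<ge> M2" "k0 \<ge> N" by (auto simp: k0_def j_def)
    have "norm (x (Suc k0) - xs) < m" unfolding k0(1) by (rule J) (simp add: j_def)
    moreover have "\<delta> k0 < m" "K * \<rho> (Suc k0) < m" using M1 M2 k0 by auto
    ultimately have "E k0 < 3 * m" unfolding E_def by linarith
    then have E0: "E k0 < e" "E k0 \<le> \<eta>" by (auto simp: m_def)
    have En: "E (k0 + n) \<le> E k0" for n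
    proof (induction n)
      case (Suc n)
      then show ?case using potential[of "k0 + n"] E0 k0(4) by simp
    qed simp
    have "norm (x n - xs) < e" if "n \<ge> Suc k0" for n
    proof -
      define i where "i = n - Suc k0"
      have n: "n = Suc (k0 + i)" using that by (simp add: i_def)
      have "0 \<le> K * \<rho> n" using K0 \<rho>0 by simp
      then have "norm (x n - xs) \<le> E (k0 + i)" using \<delta>0[of "k0 + i"] unfolding E_def n by linarith
      then show ?thesis using En[of i] E0 by linarith
    qed
    then show "\<exists>no. \<forall>n\<ge>no. norm (x n - xs) < e" by blast
  qed
qed

section \<open>First-order conditions on the faces of the cross-polytope\<close>

lemma l1_norm_eq_inner:
  fixes y \<sigma> :: "real ^ 'n"
  assumes "\<And>i. y $ i \<noteq> 0 \<Longrightarrow> sgn (y $ i) = \<sigma> $ i"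
  shows "l1_norm y = \<sigma> \<bullet> y"
proof -
  have "\<bar>y $ i\<bar> = \<sigma> $ i * y $ i" for i
    using assms[of i] by (cases "y $ i = 0") (auto simp: abs_sgn mult.commute)
  then show ?thesis by (simp add: l1_norm_def inner_vec_def)
qed

text \<open>Lagrange's rule for one inequality constraint with nonvanishing gradient: moving from a strict
  descent direction h of g by any multiple of a direction tangential to g remains a descent
  direction, so D vanishes on tangential directions.\<close>

lemma multiplier_exists:
  fixes D g :: "'a::real_vector \<Rightarrow> real"
  assumes linD: "linear D" and ling: "linear g" and V: "subspace V"
    and e: "e \<in> V" "g e \<noteq> 0"
    and descent: "\<And>d. d \<in> V \<Longrightarrow> g d < 0 \<Longrightarrow> 0 \<le> D d"
  shows "\<exists>\<nu>. \<forall>d\<in>V. D d = \<nu> * g d"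
proof -
  define h where "h = (- 1 / g e) *\<^sub>R e"
  have h: "h \<in> V" "g h = - 1" using e V ling by (auto simp: h_def subspace_scale linear_scale linear_neg subspace_neg)
  have tangential: "D d = 0" if d: "d \<in> V" "g d = 0" for d
  proof -
    have pos: "0 \<le> D h + s * D d" for s
    proof -
      have "g (h + s *\<^sub>R d) < 0" using h d ling by (simp add: linear_add linear_scale)
      moreover have "h + s *\<^sub>R d \<in> V" using V h d by (simp add: subspace_add subspace_scale)
      ultimately have "0 \<le> D (h + s *\<^sub>R d)" by (intro descent)
      then show ?thesis using linD by (simp add: linear_add linear_scale)
    qed
    show ?thesis
    proof (rule ccontr)
      assume "D d \<noteq> 0"
      then show False using pos[of "- (D h + 1) / D d"] by simp
    qed
  qed
  have "D d = (- D h) * g d" if d: "d \<in> V" for d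
  proof -
    have "D (d + g d *\<^sub>R h) = 0"
      using h d V ling by (intro tangential) (simp_all add: linear_add linear_scale subspace_add subspace_scale)
    then show ?thesis using linD by (simp add: linear_add linear_scale eq_neg_iff_add_eq_0 mult.commute)
  qed
  then show ?thesis by blast
qed

definition sign_vector :: "real ^ 'n \<Rightarrow> real ^ 'n" where
  "sign_vector y = (\<chi> i. sgn (y $ i))"

text \<open>The linear span of the face of the cross-polytope with sign pattern \<sigma>.\<close>

definition face_span :: "real ^ 'n \<Rightarrow> (real ^ 'n) set" where
  "face_span \<sigma> = {d. \<forall>i. \<sigma> $ i = 0 \<longrightarrow> d $ i = 0}"

lemma subspace_face_span: "subspace (face_span \<sigma>)"
  by (auto simp: face_span_def subspace_def)

lemma finite_range_sign_vector: "finite (range (sign_vector :: real ^ 'n \<Rightarrow> real ^ 'n))"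
proof (rule finite_subset)
  show "range sign_vector \<subseteq> vec_lambda ` (PiE (UNIV :: 'n set) (\<lambda>_. {-1, 0, 1 :: real}))"
    by (auto simp: sign_vector_def sgn_real_def intro!: imageI split: if_splits)
  show "finite (vec_lambda ` (PiE (UNIV :: 'n set) (\<lambda>_. {-1, 0, 1 :: real})))"
    by (intro finite_imageI finite_PiE) auto
qed

text \<open>Along a direction in the span of the face the sign pattern of the nonzero components persists
  for small t, so the objective is the quadratic polynomial given by the linear form \<sigma>
  \<bullet> y; half its derivative at t = 0 is the stated expression.\<close>

lemma first_variation_nonneg:
  fixes A :: "real ^ 'n ^ 'm" and y c d :: "real ^ 'n"
  assumes min: "is_arg_min (\<lambda>z. (l1_norm z)\<^sup>2 - 2 * (c \<bullet> z)) F y"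
    and d: "d \<in> face_span (sign_vector y)"
    and feasible: "eventually (\<lambda>t. F (y + t *\<^sub>R d)) (at_right 0)"
  shows "0 \<le> (sign_vector y \<bullet> y) * (sign_vector y \<bullet> d) - c \<bullet> d"
proof -
  define \<sigma> where "\<sigma> = sign_vector y"
  have signs: "eventually (\<lambda>t. \<forall>i. y $ i \<noteq> 0 \<longrightarrow> sgn ((y + t *\<^sub>R d) $ i) = \<sigma> $ i) (at_right 0)"
  proof (rule eventually_all_finite)
    fix i
    have lim: "((\<lambda>t. y $ i + t * d $ i) \<longlongrightarrow> y $ i + 0 * d $ i) (at_right 0)" by (intro tendsto_intros)
    show "eventually (\<lambda>t. y $ i \<noteq> 0 \<longrightarrow> sgn ((y + t *\<^sub>R d) $ i) = \<sigma> $ i) (at_right 0)"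
    proof (cases "y $ i" "0 :: real" rule: linorder_cases)
      case less
      then have "eventually (\<lambda>t. y $ i + t * d $ i < 0) (at_right 0)" by (intro order_tendstoD(2)[OF lim]) simp
      then show ?thesis by eventually_elim (use less in \<open>simp add: \<sigma>_def sign_vector_def\<close>)
    next
      case greater
      then have "eventually (\<lambda>t. 0 < y $ i + t * d $ i) (at_right 0)" by (intro order_tendstoD(1)[OF lim]) simp
      then show ?thesis by eventually_elim (use greater in \<open>simp add: \<sigma>_def sign_vector_def\<close>)
    qed simp
  qed
  have l1: "l1_norm y = \<sigma> \<bullet> y" by (rule l1_norm_eq_inner) (simp add: \<sigma>_def sign_vector_def)
  define D where "D = (\<sigma> \<bullet> y) * (\<sigma> \<bullet> d) - c \<bullet> d"
  have "eventually (\<lambda>t. 0 \<le> 2 * D + t * (\<sigma> \<bullet> d)\<^sup>2) (at_right 0)"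
    using signs feasible eventually_at_right_less[of 0]
  proof eventually_elim
    case (elim t)
    have "l1_norm (y + t *\<^sub>R d) = \<sigma> \<bullet> (y + t *\<^sub>R d)"
    proof (rule l1_norm_eq_inner)
      fix i assume "(y + t *\<^sub>R d) $ i \<noteq> 0"
      then have "y $ i \<noteq> 0" using d by (auto simp: face_span_def sign_vector_def sgn_eq_0_iff)
      then show "sgn ((y + t *\<^sub>R d) $ i) = \<sigma> $ i" using elim(1) by blast
    qed
    moreover have "(l1_norm y)\<^sup>2 - 2 * (c \<bullet> y) \<le> (l1_norm (y + t *\<^sub>R d))\<^sup>2 - 2 * (c \<bullet> (y + t *\<^sub>R d))"
      using min elim(2) unfolding is_arg_min_def by (meson not_less)
    ultimately have "0 \<le> t * (2 * D + t * (\<sigma> \<bullet> d)\<^sup>2)"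
      by (simp add: l1 D_def inner_add_right power2_eq_square algebra_simps)
    then show ?case using elim(3) by (simp add: zero_le_mult_iff)
  qed
  moreover have "((\<lambda>t. 2 * D + t * (\<sigma> \<bullet> d)\<^sup>2) \<longlongrightarrow> 2 * D + 0 * (\<sigma> \<bullet> d)\<^sup>2) (at_right 0)"
    by (intro tendsto_intros)
  ultimately have "0 \<le> 2 * D + 0 * (\<sigma> \<bullet> d)\<^sup>2"
    by (intro tendsto_lowerbound[where F = "at_right (0::real)"]) auto
  then show ?thesis by (simp add: D_def \<sigma>_def)
qed

section \<open>The Lojasiewicz inequality at the minimisers of the subproblems\<close>

text \<open>Used to pass from one sign pattern to the finite set of all of them.\<close>

lemma uniform_constants:
  fixes P :: "'s \<Rightarrow> real \<Rightarrow> real \<Rightarrow> bool"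
  assumes "finite S" and "\<And>s. s \<in> S \<Longrightarrow> \<exists>C>0. \<exists>\<eta>>0. P s C \<eta>"
    and mono: "\<And>s C \<eta> C' \<eta>'. P s C \<eta> \<Longrightarrow> C \<le> C' \<Longrightarrow> \<eta>' \<le> \<eta> \<Longrightarrow> P s C' \<eta>'"
  shows "\<exists>C>0. \<exists>\<eta>>0. \<forall>s\<in>S. P s C \<eta>"
  using assms(1,2)
proof (induction S rule: finite_induct)
  case empty
  show ?case by (auto intro!: exI[of _ 1])
next
  case (insert s S)
  obtain C \<eta> where 1: "C > 0" "\<eta> > 0" "\<forall>s\<in>S. P s C \<eta>" using insert by auto
  obtain C' \<eta>' where 2: "C' > 0" "\<eta>' > 0" "P s C' \<eta>'" using insert.prems by blast
  have "\<forall>s\<in>insert s S. P s (max C C') (min \<eta> \<eta>')"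
    using mono[OF 2(3), of "max C C'" "min \<eta> \<eta>'"] 1(3) mono[of _ C \<eta> "max C C'" "min \<eta> \<eta>'"] by auto
  then show ?case using 1 2 by (intro exI[of _ "max C C'"] conjI exI[of _ "min \<eta> \<eta>'"]) auto
qed

text \<open>Near \<open>xs\<close> the sign pattern can only be refined on the zero components of
  \<open>xs\<close>. Hence \<open>xs\<close> lies in the span of every face that meets a small
  neighbourhood.\<close>

lemma signs_near:
  fixes xs :: "real ^ 'n"
  shows "\<exists>\<eta>>0. \<forall>y. norm (y - xs) \<le> \<eta> \<longrightarrow> (\<forall>i. xs $ i \<noteq> 0 \<longrightarrow> sgn (xs $ i) = sign_vector y $ i)"
proof -
  define S where "S = insert 1 ((\<lambda>i. \<bar>xs $ i\<bar>) ` {i. xs $ i \<noteq> 0})"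
  have fin: "finite S" "S \<noteq> {}" by (auto simp: S_def)
  have pos: "0 < Min S" using fin by (auto simp: S_def)
  have "sgn (xs $ i) = sign_vector y $ i" if "norm (y - xs) \<le> Min S / 2" "xs $ i \<noteq> 0" for y i
  proof -
    have "Min S \<le> \<bar>xs $ i\<bar>" using fin that(2) by (intro Min_le) (auto simp: S_def)
    moreover have "\<bar>y $ i - xs $ i\<bar> \<le> norm (y - xs)" using component_le_norm_cart[of "y - xs" i] by simp
    ultimately show ?thesis using that pos by (auto simp: sign_vector_def sgn_real_def)
  qed
  then show ?thesis using pos by (intro exI[of _ "Min S / 2"]) auto
qed

text \<open>On the face of \<sigma> the excess is the quadratic form Qy \<bullet> y with Q =
  \<sigma>\<sigma>^T - \<alpha>_* I, which vanishes at \<open>xs\<close>, and the residual is c -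
  \<alpha>_* y because the first-order conditions at the minimiser y account for the rest of Qy.\<close>

lemma Lojasiewicz_on_face:
  fixes A :: "real ^ 'n ^ 'm" and b :: "real ^ 'm" and xs \<sigma> :: "real ^ 'n" and eps \<alpha>s :: real
  assumes feas: "norm (A *v xs - b) \<le> eps" and level: "(l1_norm xs)\<^sup>2 = \<alpha>s * (norm xs)\<^sup>2"
    and compatible: "\<And>i. xs $ i \<noteq> 0 \<Longrightarrow> sgn (xs $ i) = \<sigma> $ i"
  shows "\<exists>C>0. \<exists>\<eta>>0. \<forall>y c. norm (y - xs) \<le> \<eta> \<and> sign_vector y = \<sigma> \<and>
      is_arg_min (\<lambda>z. (l1_norm z)\<^sup>2 - 2 * (c \<bullet> z)) (\<lambda>z. norm (A *v z - b) \<le> eps) y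
      \<longrightarrow> \<bar>(l1_norm y)\<^sup>2 - \<alpha>s * (norm y)\<^sup>2\<bar> ^ 3 \<le> C * norm (c - \<alpha>s *\<^sub>R y) ^ 4"
proof -
  define V where "V = face_span \<sigma>"
  define Q where "Q d = (\<sigma> \<bullet> d) *\<^sub>R \<sigma> - \<alpha>s *\<^sub>R d" for d
  define minimiser where "minimiser c y \<longleftrightarrow> sign_vector y = \<sigma> \<and>
      is_arg_min (\<lambda>z. (l1_norm z)\<^sup>2 - 2 * (c \<bullet> z)) (\<lambda>z. norm (A *v z - b) \<le> eps) y" for c y
  define D where "D c y d = (\<sigma> \<bullet> y) * (\<sigma> \<bullet> d) - c \<bullet> d" for c y d
  define f where "f y = (l1_norm y)\<^sup>2 - \<alpha>s * (norm y)\<^sup>2" for y :: "real ^ 'n"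
  have V: "subspace V" by (simp add: V_def subspace_face_span)
  have linQ: "linear Q" by (rule linearI) (simp_all add: Q_def inner_add_right algebra_simps)
  have saQ: "Q x \<bullet> y = x \<bullet> Q y" for x y
    by (simp add: Q_def inner_diff_left inner_diff_right inner_commute)
  have linD: "linear (D c y)" for c y
    by (rule linearI) (simp_all add: D_def inner_add_right algebra_simps)
  have linA: "linear (\<lambda>d. A *v d)" by (rule matrix_vector_mul_linear)
  have fQ: "f y = Q y \<bullet> y" if "l1_norm y = \<sigma> \<bullet> y" for y
    using that by (simp add: f_def Q_def inner_diff_left power2_eq_square dot_square_norm)
  have "xs $ i = 0" if "\<sigma> $ i = 0" for i
    using compatible[of i] that by (cases "xs $ i = 0") (simp_all add: sgn_eq_0_iff)
  then have xsV: "xs \<in> V" by (simp add: V_def face_span_def)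
  have l1xs: "l1_norm xs = \<sigma> \<bullet> xs" using compatible by (rule l1_norm_eq_inner)
  have Qxs: "Q xs \<bullet> xs = 0" using fQ[OF l1xs] level by (simp add: f_def)
  have yV: "y \<in> V" and l1y: "l1_norm y = \<sigma> \<bullet> y" and feasy: "norm (A *v y - b) \<le> eps"
    if "minimiser c y" for c y
  proof -
    show "y \<in> V" using that
      by (auto simp: minimiser_def V_def face_span_def sign_vector_def sgn_eq_0_iff)
    show "l1_norm y = \<sigma> \<bullet> y"
      using that by (intro l1_norm_eq_inner) (auto simp: minimiser_def sign_vector_def)
    show "norm (A *v y - b) \<le> eps" using that by (auto simp: minimiser_def is_arg_min_def)
  qed
  have Dnonneg: "0 \<le> D c y d"
    if "minimiser c y" "d \<in> V" "eventually (\<lambda>t. norm (A *v (y + t *\<^sub>R d) - b) \<le> eps) (at_right 0)" for c y d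
    using first_variation_nonneg[of c "\<lambda>z. norm (A *v z - b) \<le> eps" y d] that
    by (auto simp: minimiser_def D_def V_def)
  have QD: "Q y \<bullet> d = D c y d + (c - \<alpha>s *\<^sub>R y) \<bullet> d" for c y d
    by (simp add: Q_def D_def inner_diff_left)
  have residual: "\<bar>Q y \<bullet> d - z\<bar> \<le> norm (c - \<alpha>s *\<^sub>R y) * norm d" if "D c y d = z" for c y d z
    using Cauchy_Schwarz_ineq2[of "c - \<alpha>s *\<^sub>R y" d] that QD[of y d c] by simp
  have lim: "((\<lambda>t. norm (A *v (y + t *\<^sub>R d) - b)) \<longlongrightarrow> norm (A *v (y + 0 *\<^sub>R d) - b)) (at_right 0)" for y d
  proof -
    have "isCont (\<lambda>t::real. norm (A *v (y + t *\<^sub>R d) - b)) 0"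
      by (intro continuous_intros linear_continuous_at[of "\<lambda>d. A *v d", THEN isCont_o2[rotated]])
         (simp_all add: linA)
    then show ?thesis unfolding isCont_def by (rule filterlim_at_split[THEN iffD1, THEN conjunct2])
  qed
  have inactive: "\<exists>C>0. \<exists>\<eta>>0. \<forall>y c. norm (y - xs) \<le> \<eta> \<and> minimiser c y \<and> norm (A *v y - b) < eps
      \<longrightarrow> \<bar>f y\<bar> ^ 3 \<le> C * norm (c - \<alpha>s *\<^sub>R y) ^ 4"
  proof -
    obtain C \<eta> where C: "C > 0" "\<eta> > 0" and
      *: "\<And>x R. norm (x - xs) \<le> \<eta> \<and> x - xs \<in> V \<and> 0 \<le> R \<and> (\<forall>d\<in>V. \<bar>Q x \<bullet> d\<bar> \<le> R * norm d)
        \<Longrightarrow> \<bar>Q x \<bullet> x - Q xs \<bullet> xs\<bar> ^ 3 \<le> C * R ^ 4"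
      using Lojasiewicz_quadratic_on_affine[OF linQ saQ V, of xs] by blast
    have "\<bar>f y\<bar> ^ 3 \<le> C * norm (c - \<alpha>s *\<^sub>R y) ^ 4"
      if y: "norm (y - xs) \<le> \<eta>" "minimiser c y" "norm (A *v y - b) < eps" for y c
    proof -
      have ev: "eventually (\<lambda>t. norm (A *v (y + t *\<^sub>R d) - b) \<le> eps) (at_right 0)" for d
      proof -
        have "eventually (\<lambda>t. norm (A *v (y + t *\<^sub>R d) - b) < eps) (at_right 0)"
          using y(3) by (intro order_tendstoD(2)[OF lim]) simp
        then show ?thesis by eventually_elim simp
      qed
      have "D c y d = 0" if "d \<in> V" for d
      proof -
        have "0 \<le> D c y d" "0 \<le> D c y (- d)"
          using Dnonneg[OF y(2) that ev] Dnonneg[OF y(2) subspace_neg[OF V that] ev] by auto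
        then show ?thesis using linear_neg[OF linD, of c y d] by simp
      qed
      then have "\<forall>d\<in>V. \<bar>Q y \<bullet> d\<bar> \<le> norm (c - \<alpha>s *\<^sub>R y) * norm d" using residual[of c y _ 0] by simp
      then show ?thesis
        using *[of y "norm (c - \<alpha>s *\<^sub>R y)"] y(1) fQ[OF l1y[OF y(2)]] Qxs subspace_diff[OF V yV[OF y(2)] xsV]
        by simp
    qed
    then show ?thesis using C by blast
  qed
  \<comment> \<open>A point of V at which the constraint gradient vanishes on V is mapped to the point of AV nearest to b, which is unique.\<close>
  have pythagoras: "A *v x = A *v z"
    if "x \<in> V" "z \<in> V" and orth: "\<And>d. d \<in> V \<Longrightarrow> (A *v x - b) \<bullet> (A *v d) = 0"
      and "norm (A *v x - b) = norm (A *v z - b)" for x z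
  proof -
    have "(A *v x - b) \<bullet> (A *v (z - x)) = 0" using that V by (intro orth) (simp add: subspace_diff)
    moreover have "A *v z - b = (A *v x - b) + A *v (z - x)"
      by (simp add: matrix_vector_mult_diff_distrib)
    ultimately have "(norm (A *v z - b))\<^sup>2 = (norm (A *v x - b))\<^sup>2 + (norm (A *v (z - x)))\<^sup>2"
      using norm_add_Pythagorean[of "A *v x - b" "A *v (z - x)"] by (simp only: orthogonal_def)
    then have "A *v (z - x) = 0" using that(4) by simp
    then show ?thesis by (simp add: matrix_vector_mult_diff_distrib)
  qed
  have active: "\<exists>C>0. \<exists>\<eta>>0. \<forall>y c. norm (y - xs) \<le> \<eta> \<and> minimiser c y \<and> norm (A *v y - b) = eps
      \<longrightarrow> \<bar>f y\<bar> ^ 3 \<le> C * norm (c - \<alpha>s *\<^sub>R y) ^ 4"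
  proof (cases "norm (A *v xs - b) < eps")
    case True
    obtain kA where kA: "kA > 0" "\<And>x. norm (A *v x) \<le> kA * norm x" using linear_bounded_pos[OF linA] by auto
    define \<eta> where "\<eta> = (eps - norm (A *v xs - b)) / (2 * kA)"
    have "norm (A *v y - b) < eps" if "norm (y - xs) \<le> \<eta>" for y
    proof -
      have "norm (A *v (y - xs)) \<le> kA * \<eta>"
        using kA(2)[of "y - xs"] mult_left_mono[OF that, of kA] kA(1) by linarith
      also have "\<dots> = (eps - norm (A *v xs - b)) / 2" using kA(1) by (simp add: \<eta>_def)
      finally show ?thesis
        using norm_triangle_ineq[of "A *v xs - b" "A *v (y - xs)"] True
        by (simp add: matrix_vector_mult_diff_distrib)
    qed
    moreover have "\<eta> > 0" using True kA by (simp add: \<eta>_def)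
    ultimately show ?thesis by (intro exI[of _ 1] conjI exI[of _ \<eta>]) auto
  next
    case False
    then have xs_active: "norm (A *v xs - b) = eps" using feas by simp
    show ?thesis
    proof (cases "\<exists>e\<in>V. (A *v xs - b) \<bullet> (A *v e) \<noteq> 0")
      case True
      then obtain e where e: "e \<in> V" "(A *v xs - b) \<bullet> (A *v e) \<noteq> 0" by blast
      obtain C \<eta> where C: "C > 0" "\<eta> > 0" and
        *: "\<And>x \<nu> R. norm (x - xs) \<le> \<eta> \<and> x \<in> V \<and> norm (A *v x - b) = norm (A *v xs - b) \<and> 0 \<le> R \<and>
            (\<forall>d\<in>V. \<bar>Q x \<bullet> d - \<nu> * ((A *v x - b) \<bullet> (A *v d))\<bar> \<le> R * norm d)
            \<Longrightarrow> \<bar>Q x \<bullet> x - Q xs \<bullet> xs\<bar> ^ 3 \<le> C * R ^ 4"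
        using Lojasiewicz_quadric_in_subspace[OF linQ saQ linA V xsV e] by blast
      have "\<bar>f y\<bar> ^ 3 \<le> C * norm (c - \<alpha>s *\<^sub>R y) ^ 4"
        if y: "norm (y - xs) \<le> \<eta>" "minimiser c y" "norm (A *v y - b) = eps" for y c
      proof -
        \<comment> \<open>A singular point y on the same level as the base point would share its image under A, making the base point singular.\<close>
        have "\<exists>h\<in>V. (A *v y - b) \<bullet> (A *v h) \<noteq> 0"
        proof (rule ccontr)
          assume "\<not> ?thesis"
          then have o: "(A *v y - b) \<bullet> (A *v h) = 0" if "h \<in> V" for h using that by blast
          have "A *v y = A *v xs" using y(3) xs_active by (intro pythagoras yV[OF y(2)] xsV o) auto
          then show False using o[OF e(1)] e(2) by simp
        qed
        then obtain h where h: "h \<in> V" "(A *v y - b) \<bullet> (A *v h) \<noteq> 0" by blast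
        have ling: "linear (\<lambda>d. (A *v y - b) \<bullet> (A *v d))"
          by (rule linearI) (simp_all add: matrix_vector_right_distrib inner_add_right matrix_vector_mult_scaleR)
        have "\<exists>\<nu>. \<forall>d\<in>V. D c y d = \<nu> * ((A *v y - b) \<bullet> (A *v d))"
        proof (rule multiplier_exists[OF linD ling V h])
          fix d assume d: "d \<in> V" "(A *v y - b) \<bullet> (A *v d) < 0"
          have "((\<lambda>t. 2 * ((A *v y - b) \<bullet> (A *v d)) + t * (norm (A *v d))\<^sup>2) \<longlongrightarrow>
              2 * ((A *v y - b) \<bullet> (A *v d)) + 0 * (norm (A *v d))\<^sup>2) (at_right 0)" by (intro tendsto_intros)
          then have "eventually (\<lambda>t. 2 * ((A *v y - b) \<bullet> (A *v d)) + t * (norm (A *v d))\<^sup>2 < 0) (at_right 0)"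
            by (rule order_tendstoD(2)) (use d(2) in simp)
          then have "eventually (\<lambda>t. norm (A *v (y + t *\<^sub>R d) - b) \<le> eps) (at_right 0)"
            using eventually_at_right_less[of 0]
          proof eventually_elim
            case (elim t)
            have "A *v (y + t *\<^sub>R d) - b = (A *v y - b) + t *\<^sub>R (A *v d)"
              by (simp add: matrix_vector_right_distrib matrix_vector_mult_scaleR)
            then have "(norm (A *v (y + t *\<^sub>R d) - b))\<^sup>2 = (norm (A *v y - b))\<^sup>2 +
                t * (2 * ((A *v y - b) \<bullet> (A *v d)) + t * (norm (A *v d))\<^sup>2)"
              by (simp add: power2_norm_eq_inner inner_add_left inner_add_right inner_commute algebra_simps)
            also have "\<dots> \<le> (norm (A *v y - b))\<^sup>2"
              using mult_nonneg_nonpos[of t "2 * ((A *v y - b) \<bullet> (A *v d)) + t * (norm (A *v d))\<^sup>2"] elim by simp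
            finally have "norm (A *v (y + t *\<^sub>R d) - b) \<le> norm (A *v y - b)" by (rule power2_le_imp_le) simp
            then show ?case using y(3) by simp
          qed
          then show "0 \<le> D c y d" by (rule Dnonneg[OF y(2) d(1)])
        qed
        then obtain \<nu> where "\<And>d. d \<in> V \<Longrightarrow> D c y d = \<nu> * ((A *v y - b) \<bullet> (A *v d))" by blast
        then have "\<forall>d\<in>V. \<bar>Q y \<bullet> d - \<nu> * ((A *v y - b) \<bullet> (A *v d))\<bar> \<le> norm (c - \<alpha>s *\<^sub>R y) * norm d"
          using residual by blast
        then show ?thesis
          using *[of y "norm (c - \<alpha>s *\<^sub>R y)" \<nu>] y(1,3) fQ[OF l1y[OF y(2)]] Qxs yV[OF y(2)] xs_active
          by simp
      qed
      then show ?thesis using C by blast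
    next
      case False
      define V' where "V' = {d\<in>V. A *v d = 0}"
      have V': "subspace V'"
        using V unfolding V'_def subspace_def
        by (auto simp: matrix_vector_right_distrib matrix_vector_mult_scaleR)
      obtain C \<eta> where C: "C > 0" "\<eta> > 0" and
        *: "\<And>x R. norm (x - xs) \<le> \<eta> \<and> x - xs \<in> V' \<and> 0 \<le> R \<and> (\<forall>d\<in>V'. \<bar>Q x \<bullet> d\<bar> \<le> R * norm d)
          \<Longrightarrow> \<bar>Q x \<bullet> x - Q xs \<bullet> xs\<bar> ^ 3 \<le> C * R ^ 4"
        using Lojasiewicz_quadratic_on_affine[OF linQ saQ V', of xs] by blast
      have "\<bar>f y\<bar> ^ 3 \<le> C * norm (c - \<alpha>s *\<^sub>R y) ^ 4"
        if y: "norm (y - xs) \<le> \<eta>" "minimiser c y" "norm (A *v y - b) = eps" for y c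
      proof -
        have "A *v xs = A *v y" using False y(3) xs_active by (intro pythagoras yV[OF y(2)] xsV) auto
        then have "y - xs \<in> V'" using yV[OF y(2)] xsV V
          by (simp add: V'_def subspace_diff matrix_vector_mult_diff_distrib)
        moreover have "D c y d = 0" if "d \<in> V'" for d
        proof -
          have ev: "eventually (\<lambda>t. norm (A *v (y + t *\<^sub>R h) - b) \<le> eps) (at_right 0)" if "h \<in> V'" for h
            using that y(3) by (simp add: V'_def matrix_vector_right_distrib matrix_vector_mult_scaleR)
          have "d \<in> V" "- d \<in> V" using that V by (auto simp: V'_def subspace_neg)
          then have "0 \<le> D c y d" "0 \<le> D c y (- d)"
            using Dnonneg[OF y(2) _ ev] that subspace_neg[OF V' that] by auto
          then show ?thesis using linear_neg[OF linD, of c y d] by simp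
        qed
        then have "\<forall>d\<in>V'. \<bar>Q y \<bullet> d\<bar> \<le> norm (c - \<alpha>s *\<^sub>R y) * norm d" using residual[of c y _ 0] by simp
        ultimately show ?thesis
          using *[of y "norm (c - \<alpha>s *\<^sub>R y)"] y(1) fQ[OF l1y[OF y(2)]] Qxs by simp
      qed
      then show ?thesis using C by blast
    qed
  qed
  obtain C1 \<eta>1 where 1: "C1 > 0" "\<eta>1 > 0" and i: "\<And>y c. norm (y - xs) \<le> \<eta>1 \<Longrightarrow> minimiser c y \<Longrightarrow>
      norm (A *v y - b) < eps \<Longrightarrow> \<bar>f y\<bar> ^ 3 \<le> C1 * norm (c - \<alpha>s *\<^sub>R y) ^ 4"
    using inactive by blast
  obtain C2 \<eta>2 where 2: "C2 > 0" "\<eta>2 > 0" and a: "\<And>y c. norm (y - xs) \<le> \<eta>2 \<Longrightarrow> minimiser c y \<Longrightarrow>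
      norm (A *v y - b) = eps \<Longrightarrow> \<bar>f y\<bar> ^ 3 \<le> C2 * norm (c - \<alpha>s *\<^sub>R y) ^ 4"
    using active by blast
  have "\<bar>f y\<bar> ^ 3 \<le> (C1 + C2) * norm (c - \<alpha>s *\<^sub>R y) ^ 4"
    if y: "norm (y - xs) \<le> min \<eta>1 \<eta>2" "minimiser c y" for y c
  proof -
    have "0 \<le> C1 * norm (c - \<alpha>s *\<^sub>R y) ^ 4" "0 \<le> C2 * norm (c - \<alpha>s *\<^sub>R y) ^ 4" using 1 2 by auto
    moreover have "norm (A *v y - b) < eps \<or> norm (A *v y - b) = eps" using feasy[OF y(2)] by linarith
    ultimately show ?thesis using i[OF _ y(2)] a[OF _ y(2)] y(1) unfolding distrib_right by fastforce
  qed
  then show ?thesis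
    using 1 2 unfolding minimiser_def f_def by (intro exI[of _ "C1 + C2"] conjI exI[of _ "min \<eta>1 \<eta>2"]) auto
qed

lemma Lojasiewicz_at_minimisers:
  fixes A :: "real ^ 'n ^ 'm" and b :: "real ^ 'm" and xs :: "real ^ 'n" and eps \<alpha>s :: real
  assumes feas: "norm (A *v xs - b) \<le> eps" and level: "(l1_norm xs)\<^sup>2 = \<alpha>s * (norm xs)\<^sup>2"
  shows "\<exists>C>0. \<exists>\<eta>>0. \<forall>y c. norm (y - xs) \<le> \<eta> \<and>
      is_arg_min (\<lambda>z. (l1_norm z)\<^sup>2 - 2 * (c \<bullet> z)) (\<lambda>z. norm (A *v z - b) \<le> eps) y
      \<longrightarrow> \<bar>(l1_norm y)\<^sup>2 - \<alpha>s * (norm y)\<^sup>2\<bar> ^ 3 \<le> C * norm (c - \<alpha>s *\<^sub>R y) ^ 4"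
proof -
  define P where "P \<sigma> C \<eta> \<longleftrightarrow> (\<forall>y c. norm (y - xs) \<le> \<eta> \<and> sign_vector y = \<sigma> \<and>
      is_arg_min (\<lambda>z. (l1_norm z)\<^sup>2 - 2 * (c \<bullet> z)) (\<lambda>z. norm (A *v z - b) \<le> eps) y
      \<longrightarrow> \<bar>(l1_norm y)\<^sup>2 - \<alpha>s * (norm y)\<^sup>2\<bar> ^ 3 \<le> C * norm (c - \<alpha>s *\<^sub>R y) ^ 4)" for \<sigma> C \<eta>
  obtain \<eta>0 where \<eta>0: "\<eta>0 > 0" "\<And>y i. norm (y - xs) \<le> \<eta>0 \<Longrightarrow> xs $ i \<noteq> 0 \<Longrightarrow> sgn (xs $ i) = sign_vector y $ i"
    using signs_near[of xs] by blast
  have "\<exists>C>0. \<exists>\<eta>>0. \<forall>\<sigma>\<in>range sign_vector. P \<sigma> C \<eta>"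
  proof (rule uniform_constants[OF finite_range_sign_vector])
    fix \<sigma> assume "\<sigma> \<in> range (sign_vector :: real ^ 'n \<Rightarrow> real ^ 'n)"
    show "\<exists>C>0. \<exists>\<eta>>0. P \<sigma> C \<eta>"
    proof (cases "\<forall>i. xs $ i \<noteq> 0 \<longrightarrow> sgn (xs $ i) = \<sigma> $ i")
      case True
      then show ?thesis unfolding P_def by (intro Lojasiewicz_on_face[OF feas level]) blast
    next
      case False
      then have "P \<sigma> 1 \<eta>0" unfolding P_def using \<eta>0(2) by blast
      then show ?thesis using \<eta>0(1) zero_less_one by blast
    qed
  next
    fix \<sigma> C \<eta> C' \<eta>' assume P: "P \<sigma> C \<eta>" and le: "C \<le> C'" "\<eta>' \<le> \<eta>"
    have "C * norm (c - \<alpha>s *\<^sub>R y) ^ 4 \<le> C' * norm (c - \<alpha>s *\<^sub>R y) ^ 4" for c y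
      using le(1) by (rule mult_right_mono) simp
    note weaken = this
    show "P \<sigma> C' \<eta>'"
      unfolding P_def
    proof (intro allI impI, elim conjE)
      fix y c
      assume y: "norm (y - xs) \<le> \<eta>'" "sign_vector y = \<sigma>"
        "is_arg_min (\<lambda>z. (l1_norm z)\<^sup>2 - 2 * (c \<bullet> z)) (\<lambda>z. norm (A *v z - b) \<le> eps) y"
      have "norm (y - xs) \<le> \<eta>" using y(1) le(2) by (rule order_trans)
      then have "\<bar>(l1_norm y)\<^sup>2 - \<alpha>s * (norm y)\<^sup>2\<bar> ^ 3 \<le> C * norm (c - \<alpha>s *\<^sub>R y) ^ 4"
        using P y(2,3) unfolding P_def by blast
      then show "\<bar>(l1_norm y)\<^sup>2 - \<alpha>s * (norm y)\<^sup>2\<bar> ^ 3 \<le> C' * norm (c - \<alpha>s *\<^sub>R y) ^ 4"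
        using weaken by (rule order_trans)
    qed
  qed
  then show ?thesis unfolding P_def by blast
qed

section \<open>Descent, limits and stationarity\<close>

lemma l1_norm_nonneg: "0 \<le> l1_norm y"
  by (simp add: l1_norm_def sum_nonneg)

lemma norm_le_l1_norm: "norm y \<le> l1_norm y"
  by (simp add: l1_norm_def norm_le_l1_cart)

lemma l1_norm_le_norm:
  fixes y :: "real ^ 'n"
  shows "l1_norm y \<le> real CARD('n) * norm y"
proof -
  have "l1_norm y \<le> (\<Sum>i\<in>(UNIV :: 'n set). norm y)"
    unfolding l1_norm_def by (intro sum_mono component_le_norm_cart)
  then show ?thesis by simp
qed

lemma l1_norm_triangle: "l1_norm y \<le> l1_norm z + l1_norm (y - z)"
  unfolding l1_norm_def sum.distrib[symmetric] by (intro sum_mono) auto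

lemma tendsto_l1_norm [tendsto_intros]:
  "(f \<longlongrightarrow> a) F \<Longrightarrow> ((\<lambda>t. l1_norm (f t)) \<longlongrightarrow> l1_norm a) F"
  unfolding l1_norm_def by (intro tendsto_intros)

text \<open>Needed because the residual at x_(k+1) involves \<alpha>_k while the excess to be estimated is
  that of \<alpha>_(k+1).\<close>

lemma ratio_Lipschitz:
  fixes y z :: "real ^ 'n"
  assumes "y \<noteq> 0" and \<rho>: "0 < \<rho>" "\<rho> \<le> norm z"
  shows "(l1_norm y)\<^sup>2 / (norm y)\<^sup>2 - (l1_norm z)\<^sup>2 / (norm z)\<^sup>2
    \<le> 4 * (real CARD('n))\<^sup>2 / \<rho> * norm (z - y)"
proof -
  define N where "N = real CARD('n)"
  define p where "p = l1_norm y / norm y"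
  define q where "q = l1_norm z / norm z"
  have n: "0 < norm y" "0 < norm z" using assms by auto
  have N0: "0 \<le> N" by (simp add: N_def)
  have pq: "0 \<le> p" "0 \<le> q" "p \<le> N" "q \<le> N"
    using n l1_norm_le_norm[of y] l1_norm_le_norm[of z]
    by (auto simp: p_def q_def N_def l1_norm_nonneg divide_le_eq)
  have "p - q \<le> 2 * N * norm (z - y) / \<rho>"
  proof -
    have d: "l1_norm y \<le> l1_norm z + N * norm (z - y)"
      using l1_norm_triangle[of y z] l1_norm_le_norm[of "y - z"] by (simp add: N_def norm_minus_commute)
    have e: "norm z \<le> norm y + norm (z - y)" using norm_triangle_ineq[of y "z - y"] by simp
    have "p * norm z \<le> p * (norm y + norm (z - y))" using e pq(1) by (rule mult_left_mono)
    also have "\<dots> = l1_norm y + p * norm (z - y)" using n by (simp add: p_def distrib_left)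
    also have "\<dots> \<le> (l1_norm z + N * norm (z - y)) + N * norm (z - y)"
      using d pq(3) by (intro add_mono mult_right_mono) auto
    also have "l1_norm z = q * norm z" using n by (simp add: q_def)
    finally have "(p - q) * norm z \<le> 2 * N * norm (z - y)" by (simp add: algebra_simps)
    then have "p - q \<le> 2 * N * norm (z - y) / norm z" using n(2) by (simp add: pos_le_divide_eq)
    also have "\<dots> \<le> 2 * N * norm (z - y) / \<rho>"
      using \<rho> N0 n(2) by (intro divide_left_mono) auto
    finally show ?thesis .
  qed
  then have "(p - q) * (p + q) \<le> (2 * N * norm (z - y) / \<rho>) * (p + q)"
    using pq by (intro mult_right_mono) auto
  also have "\<dots> \<le> (2 * N * norm (z - y) / \<rho>) * (2 * N)"
    using pq \<rho> N0 by (intro mult_left_mono) auto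
  finally show ?thesis
    by (simp add: p_def q_def N_def power2_eq_square power_divide algebra_simps)
qed

text \<open>Completing the square: the hypothesis says |z|_1^2 \<le> \<alpha>(|z|^2 - |z-y|^2).\<close>

lemma sufficient_decrease:
  fixes y z :: "real ^ 'n"
  assumes "y \<noteq> 0" "z \<noteq> 0" and \<alpha>: "\<alpha> = (l1_norm y)\<^sup>2 / (norm y)\<^sup>2"
    and better: "(l1_norm z)\<^sup>2 - 2 * \<alpha> * (y \<bullet> z) \<le> (l1_norm y)\<^sup>2 - 2 * \<alpha> * (y \<bullet> y)"
  shows "\<alpha> * (norm (z - y))\<^sup>2 / (norm z)\<^sup>2 \<le> \<alpha> - (l1_norm z)\<^sup>2 / (norm z)\<^sup>2"
proof -
  have "(l1_norm y)\<^sup>2 = \<alpha> * (y \<bullet> y)" using assms by (simp add: power2_norm_eq_inner)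
  then have "(l1_norm z)\<^sup>2 \<le> \<alpha> * (2 * (y \<bullet> z) - y \<bullet> y)" using better by (simp add: algebra_simps)
  also have "2 * (y \<bullet> z) - y \<bullet> y = (norm z)\<^sup>2 - (norm (z - y))\<^sup>2"
    by (simp add: power2_norm_eq_inner inner_diff_left inner_diff_right inner_commute)
  finally have "(l1_norm z)\<^sup>2 + \<alpha> * (norm (z - y))\<^sup>2 \<le> \<alpha> * (norm z)\<^sup>2" by (simp add: algebra_simps)
  then have "((l1_norm z)\<^sup>2 + \<alpha> * (norm (z - y))\<^sup>2) / (norm z)\<^sup>2 \<le> \<alpha>"
    using assms(2) by (simp add: pos_divide_le_eq)
  then show ?thesis by (simp add: add_divide_distrib)
qed

text \<open>Completing the square in the minimality of \<open>xs\<close> gives |y|_1^2 \<ge> \<alpha>|y|^2 -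
  \<alpha>|y-x_*|^2 for feasible y, hence a lower bound for the difference quotients at
  \<open>xs\<close> that tends to zero linearly.\<close>

lemma stationary_point_of_minimiser:
  fixes A :: "real ^ 'n ^ 'm" and xs :: "real ^ 'n"
  assumes feas: "norm (A *v xs - b) \<le> eps" and "eps < norm b"
    and \<alpha>: "\<alpha> = (l1_norm xs)\<^sup>2 / (norm xs)\<^sup>2"
    and min: "\<And>y. norm (A *v y - b) \<le> eps \<Longrightarrow>
      (l1_norm xs)\<^sup>2 - 2 * \<alpha> * (xs \<bullet> xs) \<le> (l1_norm y)\<^sup>2 - 2 * \<alpha> * (xs \<bullet> y)"
  shows "stationary_point (G A b eps) xs"
proof -
  have xs0: "xs \<noteq> 0" using feas assms(2) by auto
  have \<alpha>0: "0 \<le> \<alpha>" by (simp add: \<alpha>)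
  define \<kappa> where "\<kappa> = 4 * \<alpha> / (norm xs)\<^sup>2"
  have dom: "xs \<in> effective_domain (G A b eps)" using feas by (simp add: effective_domain_G)
  have Gxs: "G A b eps xs = ereal \<alpha>" using feas by (simp add: G_def indicator_fun_def \<alpha>)
  have lower: "ereal (- \<kappa> * norm (y - xs)) \<le>
      (G A b eps y - G A b eps xs - ereal (0 \<bullet> (y - xs))) / ereal (norm (y - xs))"
    if y: "y \<noteq> xs" "norm (y - xs) < norm xs / 2" for y
  proof (cases "norm (A *v y - b) \<le> eps")
    case False
    then have "G A b eps y = \<infinity>" by (simp add: G_def indicator_fun_def)
    then show ?thesis using y by (simp add: Gxs)
  next
    case True
    have ny: "norm xs / 2 \<le> norm y" using y(2) norm_triangle_ineq2[of xs "xs - y"] by (simp add: norm_minus_commute)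
    then have y0: "0 < norm y" using xs0 zero_less_norm_iff[of xs] by linarith
    define r where "r = norm (y - xs)"
    have r0: "0 < r" using y(1) by (simp add: r_def)
    have "(l1_norm xs)\<^sup>2 = \<alpha> * (xs \<bullet> xs)" using xs0 by (simp add: \<alpha> power2_norm_eq_inner)
    then have "\<alpha> * (2 * (xs \<bullet> y) - xs \<bullet> xs) \<le> (l1_norm y)\<^sup>2" using min[OF True] by (simp add: algebra_simps)
    moreover have "2 * (xs \<bullet> y) - xs \<bullet> xs = (norm y)\<^sup>2 - r\<^sup>2"
      by (simp add: r_def power2_norm_eq_inner inner_diff_left inner_diff_right inner_commute)
    ultimately have "\<alpha> * ((norm y)\<^sup>2 - r\<^sup>2) \<le> (l1_norm y)\<^sup>2" by (simp only:)
    then have "\<alpha> * (norm y)\<^sup>2 - \<alpha> * r\<^sup>2 \<le> (l1_norm y)\<^sup>2" by (simp only: right_diff_distrib)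
    then have "(\<alpha> * (norm y)\<^sup>2 - \<alpha> * r\<^sup>2) / (norm y)\<^sup>2 \<le> (l1_norm y)\<^sup>2 / (norm y)\<^sup>2"
      by (rule divide_right_mono) simp
    then have 1: "\<alpha> - \<alpha> * r\<^sup>2 / (norm y)\<^sup>2 \<le> (l1_norm y)\<^sup>2 / (norm y)\<^sup>2"
      using y0 by (simp add: diff_divide_distrib)
    have "\<alpha> * r\<^sup>2 / (norm y)\<^sup>2 \<le> \<alpha> * r\<^sup>2 / (norm xs / 2)\<^sup>2"
      using ny y0 xs0 \<alpha>0 by (intro divide_left_mono power_mono mult_pos_pos) auto
    also have "\<dots> = (\<kappa> * r) * r" by (simp add: \<kappa>_def power_divide power2_eq_square)
    finally have "- (\<kappa> * r) * r \<le> (l1_norm y)\<^sup>2 / (norm y)\<^sup>2 - \<alpha>" using 1 by simp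
    then have "- (\<kappa> * r) \<le> ((l1_norm y)\<^sup>2 / (norm y)\<^sup>2 - \<alpha>) / r" using r0 by (simp add: pos_le_divide_eq)
    moreover have "G A b eps y = ereal ((l1_norm y)\<^sup>2 / (norm y)\<^sup>2)" using True by (simp add: G_def indicator_fun_def)
    ultimately show ?thesis using r0 unfolding Gxs r_def[symmetric] by simp
  qed
  have "((\<lambda>y. - \<kappa> * norm (y - xs)) \<longlongrightarrow> - \<kappa> * norm (xs - xs)) (at xs)" by (intro tendsto_intros)
  then have "((\<lambda>y. ereal (- \<kappa> * norm (y - xs))) \<longlongrightarrow> ereal 0) (at xs)" by (intro tendsto_ereal) simp
  then have "Liminf (at xs) (\<lambda>y. ereal (- \<kappa> * norm (y - xs))) = 0"
    by (intro lim_imp_Liminf) (auto simp: zero_ereal_def)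
  moreover have "Liminf (at xs) (\<lambda>y. ereal (- \<kappa> * norm (y - xs))) \<le> Liminf (at xs)
      (\<lambda>y. (G A b eps y - G A b eps xs - ereal (0 \<bullet> (y - xs))) / ereal (norm (y - xs)))"
  proof (rule Liminf_mono)
    show "eventually (\<lambda>y. ereal (- \<kappa> * norm (y - xs)) \<le>
        (G A b eps y - G A b eps xs - ereal (0 \<bullet> (y - xs))) / ereal (norm (y - xs))) (at xs)"
      unfolding eventually_at using xs0 lower by (intro exI[of _ "norm xs / 2"]) (auto simp: dist_norm)
  qed
  ultimately have "0 \<in> regular_subdifferential (G A b eps) xs"
    unfolding regular_subdifferential_def using dom by simp
  then show ?thesis
    unfolding stationary_point_def limiting_subdifferential_def using dom
    by (intro CollectI conjI exI[of _ "\<lambda>_. xs"] exI[of _ "\<lambda>_. 0"] allI tendsto_const)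
qed

theorem theorem2:
  fixes A :: "real ^ 'n ^ 'm" and b :: "real ^ 'm" and eps :: real
    and x :: "nat \<Rightarrow> real ^ 'n" and \<alpha> :: "nat \<Rightarrow> real"
  assumes "CARD('m) < CARD('n)"
    and "rank A = CARD('m)"
    and "eps \<ge> 0"
    and "norm b > eps"
    and "A *v x 0 = b"
    and "\<alpha> 0 = (l1_norm (x 0))\<^sup>2 / (norm (x 0))\<^sup>2"
    and "\<And>k. is_arg_min (\<lambda>y. (l1_norm y)\<^sup>2 - 2 * \<alpha> k * (x k \<bullet> y))
                (\<lambda>y. norm (A *v y - b) \<le> eps) (x (Suc k))"
    and "\<And>k. \<alpha> (Suc k) = (l1_norm (x (Suc k)))\<^sup>2 / (norm (x (Suc k)))\<^sup>2"
    and "bounded (range x)"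
  shows "\<exists>xbar. x \<longlonglongrightarrow> xbar \<and> stationary_point (G A b eps) xbar"
proof -
  have linA: "linear (\<lambda>d. A *v d)" by (rule matrix_vector_mul_linear)
  have \<alpha>: "\<alpha> k = (l1_norm (x k))\<^sup>2 / (norm (x k))\<^sup>2" for k
    using assms(6,8) by (cases k) auto
  have feas: "norm (A *v x k - b) \<le> eps" for k
    using assms(3,5,7) by (cases k) (auto simp: is_arg_min_def)
  have min: "(l1_norm (x (Suc k)))\<^sup>2 - 2 * \<alpha> k * (x k \<bullet> x (Suc k)) \<le> (l1_norm y)\<^sup>2 - 2 * \<alpha> k * (x k \<bullet> y)"
    if "norm (A *v y - b) \<le> eps" for k y
    using assms(7)[of k] that unfolding is_arg_min_def by (meson not_less)
  obtain M where M: "0 < M" "\<And>k. norm (x k) \<le> M" using assms(9) by (auto simp: bounded_pos)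
  obtain kA where kA: "kA > 0" "\<And>z. norm (A *v z) \<le> kA * norm z" using linear_bounded_pos[OF linA] by auto
  define \<rho> where "\<rho> = (norm b - eps) / kA"
  have \<rho>0: "0 < \<rho>" using assms(4) kA by (simp add: \<rho>_def)
  have \<rho>_le: "\<rho> \<le> norm z" if "norm (A *v z - b) \<le> eps" for z
  proof -
    have "norm b \<le> norm (A *v z) + norm (A *v z - b)"
      using norm_triangle_ineq4[of "A *v z" "A *v z - b"] by simp
    then have "norm b - eps \<le> kA * norm z" using that kA(2)[of z] by linarith
    then show ?thesis using kA(1) by (simp add: \<rho>_def pos_divide_le_eq mult.commute)
  qed
  have nx: "\<rho> \<le> norm (x k)" for k using \<rho>_le feas by blast
  have x0: "x k \<noteq> 0" for k using nx[of k] \<rho>0 by auto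
  have \<alpha>1: "1 \<le> \<alpha> k" for k
    using norm_le_l1_norm[of "x k"] x0[of k] by (simp add: \<alpha> power_mono)
  have dec\<alpha>: "\<alpha> k * (norm (x (Suc k) - x k))\<^sup>2 / (norm (x (Suc k)))\<^sup>2 \<le> \<alpha> k - \<alpha> (Suc k)" for k
    using sufficient_decrease[OF x0[of k] x0[of "Suc k"] \<alpha> min[OF feas]] by (simp add: \<alpha>)
  have dec: "1 / M\<^sup>2 * (norm (x (Suc k) - x k))\<^sup>2 \<le> \<alpha> k - \<alpha> (Suc k)" for k
  proof -
    have "1 / M\<^sup>2 * (norm (x (Suc k) - x k))\<^sup>2 = (norm (x (Suc k) - x k))\<^sup>2 / M\<^sup>2" by simp
    also have "\<dots> \<le> (norm (x (Suc k) - x k))\<^sup>2 / (norm (x (Suc k)))\<^sup>2"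
      using M x0[of "Suc k"] by (intro divide_left_mono power_mono mult_pos_pos) auto
    also have "\<dots> \<le> \<alpha> k * (norm (x (Suc k) - x k))\<^sup>2 / (norm (x (Suc k)))\<^sup>2"
      using mult_right_mono[OF \<alpha>1[of k], of "(norm (x (Suc k) - x k))\<^sup>2"] by (intro divide_right_mono) auto
    finally show ?thesis using dec\<alpha>[of k] by linarith
  qed
  have "\<alpha> (Suc k) \<le> \<alpha> k" for k
  proof -
    have "0 \<le> 1 / M\<^sup>2 * (norm (x (Suc k) - x k))\<^sup>2" by simp
    then show ?thesis using dec[of k] by linarith
  qed
  then have "decseq \<alpha>" by (rule decseq_SucI)
  then obtain \<alpha>s where \<alpha>s: "\<alpha> \<longlonglongrightarrow> \<alpha>s" "\<And>k. \<alpha>s \<le> \<alpha> k"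
    using decseq_convergent[of \<alpha> 1] \<alpha>1 by metis
  obtain xs r where r: "strict_mono r" "(x \<circ> r) \<longlonglongrightarrow> xs"
    using bounded_imp_convergent_subsequence[OF assms(9)] by blast
  have feas_lim: "norm (A *v xs - b) \<le> eps"
  proof -
    have "(\<lambda>k. A *v (x \<circ> r) k) \<longlonglongrightarrow> A *v xs"
      using linear_continuous_at[OF linear_conv_bounded_linear[THEN iffD1, OF linA], of xs] r(2)
      by (rule isCont_tendsto_compose)
    then have "(\<lambda>k. norm (A *v (x \<circ> r) k - b)) \<longlonglongrightarrow> norm (A *v xs - b)" by (intro tendsto_intros)
    then show ?thesis by (rule LIMSEQ_le_const2) (use feas in auto)
  qed
  have xs0: "xs \<noteq> 0" using \<rho>_le[OF feas_lim] \<rho>0 by auto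
  have \<alpha>xs: "\<alpha>s = (l1_norm xs)\<^sup>2 / (norm xs)\<^sup>2"
  proof (rule LIMSEQ_unique)
    show "(\<alpha> \<circ> r) \<longlonglongrightarrow> \<alpha>s" using \<alpha>s(1) r(1) by (rule LIMSEQ_subseq_LIMSEQ)
    have "(\<lambda>k. (l1_norm ((x \<circ> r) k))\<^sup>2 / (norm ((x \<circ> r) k))\<^sup>2) \<longlonglongrightarrow> (l1_norm xs)\<^sup>2 / (norm xs)\<^sup>2"
      using xs0 by (intro tendsto_intros r(2)) simp
    then show "(\<alpha> \<circ> r) \<longlonglongrightarrow> (l1_norm xs)\<^sup>2 / (norm xs)\<^sup>2" by (simp add: o_def \<alpha>)
  qed
  have level: "(l1_norm xs)\<^sup>2 = \<alpha>s * (norm xs)\<^sup>2" using xs0 by (simp add: \<alpha>xs)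
  obtain C \<eta> where C: "C > 0" "\<eta> > 0" and Loj: "\<And>y c. norm (y - xs) \<le> \<eta> \<Longrightarrow>
      is_arg_min (\<lambda>z. (l1_norm z)\<^sup>2 - 2 * (c \<bullet> z)) (\<lambda>z. norm (A *v z - b) \<le> eps) y \<Longrightarrow>
      \<bar>(l1_norm y)\<^sup>2 - \<alpha>s * (norm y)\<^sup>2\<bar> ^ 3 \<le> C * norm (c - \<alpha>s *\<^sub>R y) ^ 4"
    using Lojasiewicz_at_minimisers[OF feas_lim level] by blast
  define v where "v k = \<alpha> k - \<alpha>s" for k
  have v0: "0 \<le> v k" for k using \<alpha>s(2)[of k] by (simp add: v_def)
  define L where "L = 4 * (real CARD('n))\<^sup>2 / \<rho>"
  have L0: "0 \<le> L" using \<rho>0 by (simp add: L_def)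
  define W where "W = \<alpha> 0 + M * L + M"
  have W0: "0 < W" using \<alpha>1[of 0] M L0 by (auto simp: W_def intro!: add_pos_pos add_pos_nonneg)
  have KL: "v (Suc k) ^ 3 \<le> (C * W ^ 4 / \<rho> ^ 6) * (norm (x (Suc k) - x k) + v (Suc k)) ^ 4"
    if near: "norm (x (Suc k) - xs) \<le> \<eta>" for k
  proof -
    define y where "y = x (Suc k)"
    define \<delta> where "\<delta> = norm (x (Suc k) - x k)"
    define w where "w = v (Suc k)"
    have w0: "0 \<le> w" and \<delta>0: "0 \<le> \<delta>" using v0 by (auto simp: w_def \<delta>_def)
    have "is_arg_min (\<lambda>z. (l1_norm z)\<^sup>2 - 2 * ((\<alpha> k *\<^sub>R x k) \<bullet> z)) (\<lambda>z. norm (A *v z - b) \<le> eps) y"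
      using assms(7)[of k] by (simp add: y_def mult.assoc)
    then have 1: "\<bar>(l1_norm y)\<^sup>2 - \<alpha>s * (norm y)\<^sup>2\<bar> ^ 3 \<le> C * norm (\<alpha> k *\<^sub>R x k - \<alpha>s *\<^sub>R y) ^ 4"
      using Loj near by (simp add: y_def)
    have f: "(l1_norm y)\<^sup>2 - \<alpha>s * (norm y)\<^sup>2 = w * (norm y)\<^sup>2"
      using x0[of "Suc k"] by (simp add: w_def v_def y_def \<alpha> left_diff_distrib)
    have "w * \<rho>\<^sup>2 \<le> w * (norm y)\<^sup>2"
      using nx[of "Suc k"] \<rho>0 w0 by (intro mult_left_mono power_mono) (auto simp: y_def)
    then have "(w * \<rho>\<^sup>2) ^ 3 \<le> (w * (norm y)\<^sup>2) ^ 3" using w0 by (intro power_mono) auto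
    also have "\<dots> \<le> C * norm (\<alpha> k *\<^sub>R x k - \<alpha>s *\<^sub>R y) ^ 4" using 1 w0 unfolding f by simp
    also have "\<dots> \<le> C * (W * (\<delta> + w)) ^ 4"
    proof (intro mult_left_mono power_mono)
      have "v k \<le> w + L * \<delta>"
        using ratio_Lipschitz[OF x0[of k] \<rho>0 nx[of "Suc k"]] by (simp add: v_def w_def L_def \<delta>_def \<alpha>)
      then have 2: "v k * norm y \<le> (w + L * \<delta>) * M"
        using M(2)[of "Suc k"] v0[of k] w0 \<delta>0 L0 by (intro mult_mono) (auto simp: y_def)
      have "\<alpha> k \<le> \<alpha> 0" using \<open>decseq \<alpha>\<close> by (simp add: decseq_def)
      then have 3: "\<alpha> k * \<delta> \<le> \<alpha> 0 * \<delta>" using \<delta>0 by (rule mult_right_mono)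
      have "\<alpha> k *\<^sub>R x k - \<alpha>s *\<^sub>R y = v k *\<^sub>R y - \<alpha> k *\<^sub>R (y - x k)" by (simp add: v_def algebra_simps)
      then have "norm (\<alpha> k *\<^sub>R x k - \<alpha>s *\<^sub>R y) \<le> norm (v k *\<^sub>R y) + norm (\<alpha> k *\<^sub>R (y - x k))"
        by (simp only: norm_triangle_ineq4)
      also have "\<dots> = v k * norm y + \<alpha> k * \<delta>"
        using v0[of k] \<alpha>1[of k] by (simp add: \<delta>_def y_def)
      also have "\<dots> \<le> (w + L * \<delta>) * M + \<alpha> 0 * \<delta>" using 2 3 by (rule add_mono)
      also have "\<dots> \<le> W * (\<delta> + w)"
      proof -
        have "0 \<le> \<alpha> 0 * w" "0 \<le> M * L * w" "0 \<le> M * \<delta>" using \<alpha>1[of 0] M L0 w0 \<delta>0 by auto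
        then show ?thesis by (simp add: W_def algebra_simps)
      qed
      finally show "norm (\<alpha> k *\<^sub>R x k - \<alpha>s *\<^sub>R y) \<le> W * (\<delta> + w)" .
    qed (use C in auto)
    finally have "w ^ 3 * \<rho> ^ 6 \<le> C * W ^ 4 * (\<delta> + w) ^ 4" by (simp add: power_mult_distrib)
    then show ?thesis using \<rho>0 by (simp add: w_def \<delta>_def field_simps)
  qed
  have vlim: "v \<longlonglongrightarrow> 0"
    using tendsto_diff[OF \<alpha>s(1) tendsto_const[of \<alpha>s]] by (simp add: v_def[abs_def])
  have "0 < C * W ^ 4 / \<rho> ^ 6" "0 < 1 / M\<^sup>2" using C W0 \<rho>0 M by auto
  moreover have "1 / M\<^sup>2 * (norm (x (Suc k) - x k))\<^sup>2 \<le> v k - v (Suc k)" for k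
    using dec[of k] by (simp add: v_def)
  ultimately have conv: "x \<longlonglongrightarrow> xs"
    using convergence_by_Lojasiewicz[OF v0 vlim _ _ C(2) _ KL r] by blast
  have "(l1_norm xs)\<^sup>2 - 2 * \<alpha>s * (xs \<bullet> xs) \<le> (l1_norm y)\<^sup>2 - 2 * \<alpha>s * (xs \<bullet> y)"
    if "norm (A *v y - b) \<le> eps" for y
  proof (rule LIMSEQ_le)
    note conv' = LIMSEQ_Suc[OF conv]
    show "(\<lambda>k. (l1_norm (x (Suc k)))\<^sup>2 - 2 * \<alpha> k * (x k \<bullet> x (Suc k))) \<longlonglongrightarrow> (l1_norm xs)\<^sup>2 - 2 * \<alpha>s * (xs \<bullet> xs)"
      by (intro tendsto_intros conv conv' \<alpha>s)
    show "(\<lambda>k. (l1_norm y)\<^sup>2 - 2 * \<alpha> k * (x k \<bullet> y)) \<longlonglongrightarrow> (l1_norm y)\<^sup>2 - 2 * \<alpha>s * (xs \<bullet> y)"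
      by (intro tendsto_intros conv \<alpha>s)
  qed (use min[OF that] in auto)
  then have "stationary_point (G A b eps) xs"
    using stationary_point_of_minimiser[OF feas_lim assms(4) \<alpha>xs] by blast
  then show ?thesis using conv by blast
qed

end
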